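(* Let $\mathcal A$ be a separable commutative Banach algebra, let $G$ be an abelian compact Hausdorff group, and let $1<p<\infty$. Then $$\Delta(L^p(G,\mathcal A))=\{(\chi\otimes\varphi)|_{L^p(G,\mathcal A)}:\ \chi\in\widehat G,\ \varphi\in\Delta(\mathcal A)\}.$$
   Context: All algebras are over $\mathbb C$. For a commutative Banach algebra $\mathcal B$, $\Delta(\mathcal B)$ is the set of nonzero multiplicative linear functionals on $\mathcal B$. $\lambda$ is the Haar measure on $G$ with $\lambda(G)=1$. For $1\le p<\infty$, $L^p(G,\mathcal A)$ is the space of (classes modulo $\lambda$-a.e. equality of) Borel measurable functions $f:G\to\mathcal A$ with $\|f\|_{p,\mathcal A}=\left(\int_G\|f(x)\|_{\mathcal A}^p\,d\lambda(x)\right)^{1/p}<\infty$; it is a Banach algebra under convolution $(f*g)(x)=\int_G f(y)g(y^{-1}x)\,d\lambda(y)$, and $L^p(G,\mathcal A)\subseteq L^1(G,\mathcal A)$. $\widehat G$ is the dual group of $G$ (continuous homomorphisms from $G$ to the unit circle). For $\chi\in\widehat G$ and $\varphi\in\Delta(\mathcal A)$, $\chi\otimes\varphi$ is the functional on $L^1(G,\mathcal A)$ given by $(\chi\otimes\varphi)(f)=\int_G\overline{\chi(x)}\,\varphi(f(x))\,d\lambda(x)$. *)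

theory Defs
  imports "HOL-Analysis.Analysis"
begin

section \<open>Commutative complex Banach algebras\<close>

text \<open>
  The distribution only has real normed algebras, so the complex scalar multiplication is added
  on top of them. No unit is required: \<open>real_normed_algebra\<close> and \<open>comm_ring\<close> are both the
  non-unital classes. Compatibility with multiplication in the second argument follows
  from commutativity.
\<close>

class comm_complex_banach_algebra = real_normed_algebra + banach + comm_ring +
  fixes scaleC :: "complex \<Rightarrow> 'a \<Rightarrow> 'a"
  assumes scaleC_add_right: "scaleC c (x + y) = scaleC c x + scaleC c y"
    and scaleC_add_left: "scaleC (c + d) x = scaleC c x + scaleC d x"
    and scaleC_scaleC: "scaleC c (scaleC d x) = scaleC (c * d) x"
    and scaleR_eq_scaleC: "r *\<^sub>R x = scaleC (complex_of_real r) x"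
    and mult_scaleC_left: "scaleC c x * y = scaleC c (x * y)"
    and norm_scaleC: "norm (scaleC c x) = cmod c * norm x"

text \<open>
  Separability in the metric sense. The derived second countability is what the Bochner
  integral requires of its target type.
\<close>

class separable_metric_space = metric_space +
  assumes ex_countable_dense: "\<exists>D. countable D \<and> (\<forall>x. \<forall>e>0. \<exists>d\<in>D. dist d x < e)"

instance separable_metric_space \<subseteq> second_countable_topology
proof
  obtain D :: "'a set" where D: "countable D" "\<And>x e. e > 0 \<Longrightarrow> \<exists>d\<in>D. dist d x < e"
    using ex_countable_dense by blast
  define B where "B = (\<lambda>(d, n). ball d (1 / real (Suc n))) ` (D \<times> (UNIV :: nat set))"
  have "topological_basis B"
  proof (rule topological_basisI)
    show "open b" if "b \<in> B" for b
      using that by (auto simp: B_def)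
  next
    fix U :: "'a set" and x assume "open U" "x \<in> U"
    then obtain e where e: "e > 0" "ball x e \<subseteq> U"
      by (auto simp: open_contains_ball)
    obtain n where n: "1 / real (Suc n) < e / 2"
      using reals_Archimedean[of "e / 2"] e(1) by (auto simp: inverse_eq_divide)
    obtain d where d: "d \<in> D" "dist d x < 1 / real (Suc n)"
      using D(2)[of "1 / real (Suc n)" x] by auto
    have "ball d (1 / real (Suc n)) \<subseteq> ball x e"
    proof
      fix y assume "y \<in> ball d (1 / real (Suc n))"
      then have "dist x y < 1 / real (Suc n) + 1 / real (Suc n)"
        using dist_triangle[of x y d] d(2) by (simp add: dist_commute)
      then show "y \<in> ball x e" using n by simp
    qed
    with d e(2) show "\<exists>b\<in>B. x \<in> b \<and> b \<subseteq> U"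
      by (intro bexI[of _ "ball d (1 / real (Suc n))"]) (auto simp: B_def dist_commute)
  qed
  moreover have "countable B"
    using D(1) by (simp add: B_def)
  ultimately show "\<exists>B :: 'a set set. countable B \<and> open = generate_topology B"
    using topological_basis_imp_subbasis by blast
qed

section \<open>Multiplicative linear functionals\<close>

record 'b complex_algebra =
  alg_carrier :: "'b set"
  alg_add :: "'b \<Rightarrow> 'b \<Rightarrow> 'b"
  alg_scale :: "complex \<Rightarrow> 'b \<Rightarrow> 'b"
  alg_mult :: "'b \<Rightarrow> 'b \<Rightarrow> 'b"

text \<open>
  A functional on a carrier is a HOL function that is \<open>undefined\<close> outside it, so that equality
  of HOL functions is equality of functionals on the carrier.
\<close>

definition gelfand_spectrum :: "'b complex_algebra \<Rightarrow> ('b \<Rightarrow> complex) set" where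
  "gelfand_spectrum B = {\<phi> \<in> extensional (alg_carrier B).
     (\<forall>x\<in>alg_carrier B. \<forall>y\<in>alg_carrier B. \<phi> (alg_add B x y) = \<phi> x + \<phi> y) \<and>
     (\<forall>c. \<forall>x\<in>alg_carrier B. \<phi> (alg_scale B c x) = c * \<phi> x) \<and>
     (\<forall>x\<in>alg_carrier B. \<forall>y\<in>alg_carrier B. \<phi> (alg_mult B x y) = \<phi> x * \<phi> y) \<and>
     (\<exists>x\<in>alg_carrier B. \<phi> x \<noteq> 0)}"

definition type_algebra :: "'a::comm_complex_banach_algebra complex_algebra" where
  "type_algebra = \<lparr>alg_carrier = UNIV, alg_add = (+), alg_scale = scaleC, alg_mult = (*)\<rparr>"

section \<open>Haar measure and dual group\<close>

text \<open>
  The normalised Haar measure of a compact abelian group, written additively, as the regular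
  (Radon) translation-invariant Borel probability measure. Regularity cannot be dropped, since the
  group need not be metrizable.
\<close>

definition haar_prob_measure :: "'g::topological_ab_group_add measure \<Rightarrow> bool" where
  "haar_prob_measure M \<longleftrightarrow>
     sets M = sets borel \<and>
     emeasure M UNIV = 1 \<and>
     (\<forall>a. \<forall>B\<in>sets borel. emeasure M ((+) a ` B) = emeasure M B) \<and>
     (\<forall>B\<in>sets borel. emeasure M B = (INF U\<in>{U. B \<subseteq> U \<and> open U}. emeasure M U)) \<and>
     (\<forall>U. open U \<longrightarrow> emeasure M U = (SUP K\<in>{K. K \<subseteq> U \<and> compact K}. emeasure M K))"

definition dual_group :: "('g::topological_ab_group_add \<Rightarrow> complex) set" where
  "dual_group = {\<gamma>. continuous_on UNIV \<gamma> \<and> (\<forall>x y. \<gamma> (x + y) = \<gamma> x * \<gamma> y) \<and> (\<forall>x. cmod (\<gamma> x) = 1)}"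

section \<open>Vector-valued Lebesgue spaces\<close>

definition Lp_functions ::
  "'g measure \<Rightarrow> real \<Rightarrow> ('g \<Rightarrow> 'a::{real_normed_vector, second_countable_topology}) set" where
  "Lp_functions M p =
     {f \<in> borel_measurable M. (\<integral>\<^sup>+x. ennreal (norm (f x) powr p) \<partial>M) < \<infinity>}"

text \<open>
  Classes are taken among all measurable functions. The class of a function thus does not depend
  on the exponent, and \<open>L\<^sup>p\<close> is literally a subset of \<open>L\<^sup>1\<close>.
\<close>

definition ae_class ::
  "'g measure \<Rightarrow> ('g \<Rightarrow> 'a::{real_normed_vector, second_countable_topology}) \<Rightarrow> ('g \<Rightarrow> 'a) set" where
  "ae_class M f = {g \<in> borel_measurable M. AE x in M. g x = f x}"

definition rep :: "('g \<Rightarrow> 'a) set \<Rightarrow> 'g \<Rightarrow> 'a" where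
  "rep X = (SOME f. f \<in> X)"

text \<open>
  At the null set of points where the integrand is not integrable the value is 0, by the
  convention of the Bochner integral.
\<close>

definition convolution :: "'g::ab_group_add measure \<Rightarrow>
    ('g \<Rightarrow> 'a::{comm_complex_banach_algebra, second_countable_topology}) \<Rightarrow> ('g \<Rightarrow> 'a) \<Rightarrow> 'g \<Rightarrow> 'a" where
  "convolution M f g x = (\<integral>y. f y * g (- y + x) \<partial>M)"

text \<open>The operations do not depend on the representatives chosen by \<open>rep\<close>.\<close>

definition Lp_algebra :: "'g::ab_group_add measure \<Rightarrow> real \<Rightarrow>
    ('g \<Rightarrow> 'a::{comm_complex_banach_algebra, second_countable_topology}) set complex_algebra" where
  "Lp_algebra M p =
     \<lparr>alg_carrier = ae_class M ` Lp_functions M p,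
      alg_add = (\<lambda>X Y. ae_class M (\<lambda>x. rep X x + rep Y x)),
      alg_scale = (\<lambda>c X. ae_class M (\<lambda>x. scaleC c (rep X x))),
      alg_mult = (\<lambda>X Y. ae_class M (convolution M (rep X) (rep Y)))\<rparr>"

lemma Lp_carrier_subset_L1:
  fixes M :: "'g::ab_group_add measure"
  assumes "emeasure M (space M) = 1" and "1 \<le> p"
  shows "alg_carrier (Lp_algebra M p ::
      ('g \<Rightarrow> 'a::{comm_complex_banach_algebra, second_countable_topology}) set complex_algebra)
    \<subseteq> alg_carrier (Lp_algebra M 1)"
proof -
  have "f \<in> Lp_functions M 1" if f: "f \<in> Lp_functions M p" for f :: "'g \<Rightarrow> 'a"
  proof -
    have [measurable]: "f \<in> borel_measurable M" and
      fin: "(\<integral>\<^sup>+x. ennreal (norm (f x) powr p) \<partial>M) < \<infinity>"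
      using f by (auto simp: Lp_functions_def)
    have le: "t powr 1 \<le> 1 + t powr p" if "t \<ge> 0" for t :: real
    proof (cases "t \<le> 1")
      case True
      then show ?thesis using that powr_ge_zero[of t p] by (simp add: add_increasing2)
    next
      case False
      then have "t powr 1 \<le> t powr p" using assms(2) by (intro powr_mono) auto
      then show ?thesis by simp
    qed
    have "(\<integral>\<^sup>+x. ennreal (norm (f x) powr 1) \<partial>M)
        \<le> (\<integral>\<^sup>+x. 1 + ennreal (norm (f x) powr p) \<partial>M)"
    proof (rule nn_integral_mono)
      fix x
      have "ennreal (norm (f x) powr 1) \<le> ennreal (1 + norm (f x) powr p)"
        using le[OF norm_ge_zero, of "f x"] by (rule ennreal_leI)
      then show "ennreal (norm (f x) powr 1) \<le> 1 + ennreal (norm (f x) powr p)"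
        by simp
    qed
    also have "\<dots> = 1 + (\<integral>\<^sup>+x. ennreal (norm (f x) powr p) \<partial>M)"
      using assms(1) by (subst nn_integral_add) auto
    also have "\<dots> < \<infinity>" using fin by simp
    finally show ?thesis by (simp add: Lp_functions_def)
  qed
  then show ?thesis by (auto simp: Lp_algebra_def)
qed

definition character_tensor :: "'g::topological_ab_group_add measure \<Rightarrow> ('g \<Rightarrow> complex) \<Rightarrow>
    ('a::{comm_complex_banach_algebra, second_countable_topology} \<Rightarrow> complex) \<Rightarrow>
    ('g \<Rightarrow> 'a) set \<Rightarrow> complex" where
  "character_tensor M \<gamma> \<phi> =
     restrict (\<lambda>X. \<integral>x. cnj (\<gamma> x) * \<phi> (rep X x) \<partial>M) (alg_carrier (Lp_algebra M 1))"

end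

theory Submission
  imports Defs
begin

text \<open>
  A multiplicative functional \<open>\<Psi>\<close> on \<open>L\<^sup>p\<close> is automatically continuous, hence does not vanish on some
  \<open>u a\<close> with \<open>u\<close> continuous and real and \<open>a \<in> A\<close>. Since the translates \<open>f\<^sub>y\<close> of a function satisfy
  \<open>f\<^sub>y * g = f * g\<^sub>y\<close>, one has \<open>\<Psi> (f\<^sub>y) = cnj (\<gamma> y) \<Psi> f\<close> for a character \<open>\<gamma>\<close>. The convolution of \<open>\<gamma>\<close> with
  \<open>u\<close> is a multiple of \<open>\<gamma>\<close> and a uniform limit of Riemann sums of translates of \<open>u\<close>, which gives
  \<open>\<Psi> (\<gamma> a) \<noteq> 0\<close>. Then \<open>\<phi> b = \<Psi> (\<gamma> b)\<close> is multiplicative because \<open>\<gamma> * \<gamma> = \<gamma>\<close>, and applying \<open>\<Psi>\<close> to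
  \<open>f * \<gamma> a = \<gamma> (\<integral> cnj \<gamma> f) a\<close> yields \<open>\<Psi> f = \<phi> (\<integral> cnj \<gamma> f)\<close>. The density of trigonometric
  polynomials is not needed.

  When the group is not second countable, its Borel sets on the square may exceed the product of
  the Borel sigma-algebras, and \<open>(x, y) \<mapsto> f y g (x - y)\<close> need not be jointly measurable for Borel
  \<open>f\<close> and \<open>g\<close>. Fubini arguments are therefore run on the Baire sigma-algebra, for which
  \<open>(x, y) \<mapsto> x - y\<close> is jointly measurable; regularity of the Haar measure provides a Baire measurable
  representative of every Borel measurable function.
\<close>

section \<open>Baire sets of a compact group\<close>

text \<open>Two obstacles shape the development. Convolution evaluates \<open>g\<close> at
  \<open>- y + x\<close>, so it is well defined on classes only if inversion preserves null sets.
  The measure is invariant under translations by definition, and uniqueness of Haar measure is not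
  invoked; inversion is treated on Baire sets by Fubini, and regularity carries the result to open
  sets and to null sets. The second obstacle is that \<open>\<Psi>\<close> comes without any
  continuity. Completeness of L^p is not set up for this: the one series that the argument sums is
  built pointwise, and the inequalities of Young and Jensen place its sum in L^p. Likewise no
  L^p-valued integral is formed when \<open>\<Psi>\<close> is moved past the convolution of
  \<open>\<gamma>\<close> with \<open>u\<close>: finite sums replace the integral with a uniform
  error, which the sup norm bound on \<open>\<Psi>\<close> absorbs. Both these sums and the joint
  measurability of subtraction rest on one construction, a Baire measurable selection with finitely
  many values that moves the translates of \<open>u\<close> by a uniformly small amount.\<close>

definition baire :: "'a::topological_space measure" where
  "baire = sigma UNIV {{x. 0 < u x} | u. continuous_on UNIV (u :: 'a \<Rightarrow> real)}"

lemma space_baire [simp]: "space baire = UNIV"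
  by (simp add: baire_def)

lemma sets_baire: "sets baire = sigma_sets UNIV {{x. 0 < u x} | u. continuous_on UNIV (u :: 'a::topological_space \<Rightarrow> real)}"
  by (simp add: baire_def)

lemma positive_set_baire: "continuous_on UNIV u \<Longrightarrow> {x. 0 < u x} \<in> sets baire" for u :: "_ \<Rightarrow> real"
  unfolding sets_baire by (intro sigma_sets.Basic) auto

lemma continuous_real_imp_measurable_baire:
  fixes u :: "'a::topological_space \<Rightarrow> real"
  assumes "continuous_on UNIV u"
  shows "u \<in> borel_measurable baire"
proof (subst borel_measurable_iff_greater, intro allI)
  fix c
  have "{x. 0 < u x - c} \<in> sets baire"
    by (intro positive_set_baire continuous_intros assms)
  then show "{x \<in> space baire. c < u x} \<in> sets baire"
    by simp
qed

lemma continuous_complex_imp_measurable_baire: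
  fixes u :: "'a::topological_space \<Rightarrow> complex"
  assumes "continuous_on UNIV u"
  shows "u \<in> borel_measurable baire"
  unfolding borel_measurable_complex_iff
  by (intro conjI continuous_real_imp_measurable_baire continuous_intros assms)

text \<open>Measurability into the Baire sigma-algebra is tested on real continuous functions.
  Approximation can thus be carried out on the real values \<open>u (f x)\<close>, where pointwise
  limits preserve measurability.\<close>

lemma measurable_into_baireI:
  assumes "\<And>u :: 'a::topological_space \<Rightarrow> real. continuous_on UNIV u \<Longrightarrow> (\<lambda>x. u (f x)) \<in> borel_measurable X"
  shows "f \<in> measurable X baire"
  unfolding baire_def
proof (rule measurable_measure_of)
  fix B :: "'a set" assume "B \<in> {{x. 0 < u x} | u. continuous_on UNIV (u :: 'a \<Rightarrow> real)}"
  then obtain u :: "'a \<Rightarrow> real" where B: "B = {x. 0 < u x}" and u: "continuous_on UNIV u"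
    by auto
  have [measurable]: "(\<lambda>x. u (f x)) \<in> borel_measurable X"
    by (rule assms[OF u])
  have "{x \<in> space X. 0 < u (f x)} \<in> sets X"
    by measurable
  then show "f -` B \<inter> space X \<in> sets X"
    by (simp add: B vimage_def Int_def conj_commute)
qed auto

lemma continuous_imp_measurable_baire_baire:
  fixes f :: "'a::topological_space \<Rightarrow> 'b::topological_space"
  assumes "continuous_on UNIV f"
  shows "f \<in> measurable baire baire"
  by (intro measurable_into_baireI continuous_real_imp_measurable_baire)
     (rule continuous_on_compose2[OF _ assms], auto)

lemma sets_baire_subset_borel: "sets (baire :: 'a::topological_space measure) \<subseteq> sets borel"
proof -
  have "open {x. 0 < u x}" if "continuous_on UNIV u" for u :: "'a \<Rightarrow> real"
    using that by (intro open_Collect_less) (auto intro: continuous_intros)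
  then show ?thesis
    unfolding sets_baire by (intro sets.sigma_sets_subset') auto
qed

section \<open>Urysohn functions and uniform continuity of translations\<close>

lemma urysohn_compact_UNIV:
  fixes K U :: "'a::t2_space set"
  assumes "compact (UNIV :: 'a set)" "closed K" "open U" "K \<subseteq> U"
  obtains u :: "'a \<Rightarrow> real"
  where "continuous_on UNIV u" "\<And>x. 0 \<le> u x" "\<And>x. u x \<le> 1" "\<And>x. x \<in> K \<Longrightarrow> u x = 1" "\<And>x. x \<notin> U \<Longrightarrow> u x = 0"
proof -
  have "Hausdorff_space (euclidean :: 'a topology)"
    unfolding Hausdorff_space_def using hausdorff by (auto simp: disjnt_def)
  moreover have "compact_space (euclidean :: 'a topology)"
    using assms(1) by (simp add: compact_space_def)
  ultimately have "normal_space (euclidean :: 'a topology)"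
    by (intro compact_Hausdorff_or_regular_imp_normal_space) auto
  moreover have "closedin euclidean (-U)" "closedin euclidean K" "disjnt (-U) K"
    using assms by (auto simp: disjnt_def closed_closedin[symmetric])
  ultimately obtain u where u: "continuous_map euclidean (top_of_set {0..1::real}) u"
      "u ` (-U) \<subseteq> {0}" "u ` K \<subseteq> {1}"
    using Urysohn_lemma[of euclidean "-U" K 0 1] by auto
  have "continuous_on UNIV u"
    using u(1) by (simp add: continuous_map_in_subtopology)
  moreover have "0 \<le> u x" "u x \<le> 1" for x
    using u(1) by (auto simp: continuous_map_in_subtopology image_subset_iff)
  ultimately show thesis
    using u(2,3) by (intro that[of u]) auto
qed

text \<open>A tube argument: each \<open>(x, 0)\<close> lies in the open set \<open>O'\<close>,
  finitely many of the \<open>A x\<close> cover the group, and the corresponding \<open>B x\<close>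
  intersect in \<open>W\<close>. The bound is uniform in \<open>x\<close> because \<open>O'\<close>
  is used at the moving point \<open>- z + x\<close>.\<close>

lemma uniformly_continuous_translate:
  fixes u :: "'g::{topological_ab_group_add, t2_space} \<Rightarrow> 'b::metric_space"
  assumes compact: "compact (UNIV :: 'g set)" and u: "continuous_on UNIV u" and e: "e > 0"
  obtains W where "open W" "0 \<in> W" "\<And>x y z. y - z \<in> W \<Longrightarrow> dist (u (- y + x)) (u (- z + x)) < e"
proof -
  define O' where "O' = {q :: 'g \<times> 'g. dist (u (- snd q + fst q)) (u (fst q)) < e}"
  have "continuous_on UNIV (\<lambda>q :: 'g \<times> 'g. - snd q + fst q)"
    by (intro continuous_intros)
  then have c1: "continuous_on UNIV (\<lambda>q :: 'g \<times> 'g. u (- snd q + fst q))"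
    by (rule continuous_on_compose2[OF u]) auto
  have c2: "continuous_on UNIV (\<lambda>q :: 'g \<times> 'g. u (fst q))"
    by (rule continuous_on_compose2[OF u]) (auto intro: continuous_intros)
  have "open O'"
    unfolding O'_def by (intro open_Collect_less continuous_on_dist c1 c2 continuous_on_const)
  have "\<exists>A B. open A \<and> x \<in> A \<and> open B \<and> 0 \<in> B \<and> A \<times> B \<subseteq> O'" for x
  proof -
    have "(x, 0) \<in> O'" using e by (simp add: O'_def)
    then show ?thesis using \<open>open O'\<close>
      by (metis open_prod_elim mem_Sigma_iff)
  qed
  then obtain A B where AB: "\<And>x. open (A x)" "\<And>x. x \<in> A x" "\<And>x. open (B x)" "\<And>x. 0 \<in> B x"
      "\<And>x. A x \<times> B x \<subseteq> O'"
    by metis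
  obtain F where F: "finite F" "UNIV \<subseteq> (\<Union>x\<in>F. A x)"
    using compactE_image[OF compact, of UNIV A] AB by (metis UNIV_I UN_I subsetI)
  define W where "W = (\<Inter>x\<in>F. B x)"
  show thesis
  proof
    show "open W" unfolding W_def using F AB by auto
    show "0 \<in> W" using AB by (auto simp: W_def)
    fix x y z assume "y - z \<in> W"
    obtain a where "a \<in> F" "- z + x \<in> A a"
      using F by blast
    \<comment> \<open>Since \<open>- y + x = - (y - z) + (- z + x)\<close>, this membership is the
      claimed estimate.\<close>
    then have "(- z + x, y - z) \<in> O'"
      using AB(5)[of a] \<open>y - z \<in> W\<close> by (auto simp: W_def)
    then show "dist (u (- y + x)) (u (- z + x)) < e"
      by (simp add: O'_def algebra_simps)
  qed
qed

text \<open>The group is cut into finitely many Baire pieces on which \<open>s\<close> is constant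
  and \<open>y - s y\<close> stays in the neighbourhood \<open>W\<close>. Urysohn functions are
  brought in because translates of \<open>W\<close> need not be Baire sets, whereas positivity sets
  of continuous functions are.\<close>

lemma finite_valued_translate_approx:
  fixes u :: "'g::{topological_ab_group_add, t2_space} \<Rightarrow> 'b::metric_space"
  assumes compact: "compact (UNIV :: 'g set)" and u: "continuous_on UNIV u" and e: "e > 0"
  obtains s :: "'g \<Rightarrow> 'g" where "finite (range s)" "\<And>z. s -` {z} \<in> sets baire"
    "\<And>x y. dist (u (- y + x)) (u (- s y + x)) < e"
proof -
  obtain W where W: "open W" "0 \<in> W" "\<And>x y z. y - z \<in> W \<Longrightarrow> dist (u (- y + x)) (u (- z + x)) < e"
    by (rule uniformly_continuous_translate[OF assms]) (use that in auto)
  obtain w :: "'g \<Rightarrow> real" where w: "continuous_on UNIV w" "w 0 = 1" "\<And>x. x \<notin> W \<Longrightarrow> w x = 0"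
    using urysohn_compact_UNIV[OF compact, of "{0}" W] W by (metis closed_singleton empty_subsetI insert_subset singletonI)
  define B where "B z = {y. 0 < w (y - z)}" for z
  have cont: "continuous_on UNIV (\<lambda>y. w (y - z))" for z
  proof (rule continuous_on_compose2[OF w(1)])
    show "continuous_on UNIV (\<lambda>y. y - z)"
      by (intro continuous_intros)
  qed auto
  have B: "B z \<in> sets baire" "open (B z)" "z \<in> B z" for z
    unfolding B_def using cont[of z] w(2)
    by (auto intro!: positive_set_baire open_Collect_less continuous_on_const)
  obtain F where F: "finite F" "UNIV \<subseteq> (\<Union>z\<in>F. B z)"
    using compactE_image[OF compact, of UNIV B] B by (metis UNIV_I UN_I subsetI)
  obtain zs where zs: "set zs = F"
    using F(1) finite_list by blast
  have ex: "\<exists>i<length zs. y \<in> B (zs ! i)" for y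
    using F(2) zs by (metis UNIV_I UN_iff in_set_conv_nth subset_eq)
  \<comment> \<open>Choosing the least admissible index makes the selection measurable.\<close>
  define k where "k y = (LEAST i. i < length zs \<and> y \<in> B (zs ! i))" for y
  have k: "k y < length zs" "y \<in> B (zs ! k y)" for y
    using LeastI_ex[OF ex[of y]] by (auto simp: k_def)
  have [measurable]: "k \<in> measurable baire (count_space UNIV)"
  proof -
    have [measurable]: "B z \<in> sets baire" for z by (rule B)
    have [measurable]: "(\<lambda>y. i < length zs \<and> y \<in> B (zs ! i)) \<in> measurable baire (count_space UNIV)" for i
      by measurable
    show ?thesis unfolding k_def by measurable
  qed
  define s where "s y = zs ! k y" for y
  show thesis
  proof
    have "range s \<subseteq> F" using k(1) zs by (auto simp: s_def)
    then show "finite (range s)" using F(1) finite_subset by auto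
    show "s -` {z} \<in> sets baire" for z
    proof -
      have "{y \<in> space baire. zs ! k y = z} \<in> sets baire"
        by measurable
      then show ?thesis by (simp add: s_def vimage_def)
    qed
    fix x y
    have "y - s y \<in> W"
      using k(2)[of y] w(3)[of "y - s y"] by (auto simp: s_def B_def)
    then show "dist (u (- y + x)) (u (- s y + x)) < e"
      by (rule W(3))
  qed
qed

text \<open>For continuous \<open>u\<close>, replacing \<open>y\<close> by \<open>s n y\<close>
  turns \<open>u (- y + x)\<close> into a finite sum of products of a function of \<open>x\<close>
  and a function of \<open>y\<close>, which is measurable for the product sigma-algebra. The error
  tends to 0, so the limit is measurable as well.\<close>

lemma measurable_minus_plus_baire:
  assumes compact: "compact (UNIV :: 'g::{topological_ab_group_add, t2_space} set)"
  shows "(\<lambda>(x, y). - y + x :: 'g) \<in> measurable (baire \<Otimes>\<^sub>M baire) baire"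
proof (rule measurable_into_baireI)
  fix u :: "'g \<Rightarrow> real" assume u: "continuous_on UNIV u"
  have "\<exists>s :: 'g \<Rightarrow> 'g. finite (range s) \<and> (\<forall>z. s -` {z} \<in> sets baire) \<and>
      (\<forall>x y. dist (u (- y + x)) (u (- s y + x)) < inverse (real (Suc n)))" for n
    by (rule finite_valued_translate_approx[OF compact u, of "inverse (real (Suc n))"]) auto
  then obtain s :: "nat \<Rightarrow> 'g \<Rightarrow> 'g" where s: "\<And>n. finite (range (s n))" "\<And>n z. s n -` {z} \<in> sets baire"
      "\<And>n x y. dist (u (- y + x)) (u (- s n y + x)) < inverse (real (Suc n))"
    by metis
  have m: "(\<lambda>(x, y). u (- s n y + x)) \<in> borel_measurable (baire \<Otimes>\<^sub>M baire)" for n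
  proof -
    have sets[measurable]: "s n -` {z} \<in> sets baire" for z by (rule s)
    have [measurable]: "(\<lambda>x. u (- z + x)) \<in> borel_measurable baire" for z
    proof (rule continuous_real_imp_measurable_baire)
      show "continuous_on UNIV (\<lambda>x. u (- z + x))"
      proof (rule continuous_on_compose2[OF u])
        show "continuous_on UNIV (\<lambda>x. - z + x)"
          by (intro continuous_intros)
      qed auto
    qed
    have "(\<lambda>(x, y). u (- s n y + x)) =
        (\<lambda>(x, y). \<Sum>z\<in>range (s n). indicator (s n -` {z}) y * u (- z + x))"
    proof (intro ext, clarify)
      fix x y
      have "(\<Sum>z\<in>range (s n). indicator (s n -` {z}) y * u (- z + x)) =
          (\<Sum>z\<in>range (s n). if z = s n y then u (- z + x) else 0)"
        by (intro sum.cong) (auto simp: indicator_def)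
      also have "\<dots> = u (- s n y + x)"
        using s(1) by (subst sum.delta) auto
      finally show "u (- s n y + x) = (\<Sum>z\<in>range (s n). indicator (s n -` {z}) y * u (- z + x))"
        by simp
    qed
    moreover have "(\<lambda>(x, y). \<Sum>z\<in>range (s n). indicator (s n -` {z}) y * u (- z + x))
        \<in> borel_measurable (baire \<Otimes>\<^sub>M baire)"
      by measurable
    ultimately show ?thesis by (simp only:)
  qed
  show "(\<lambda>q. u (case q of (x, y) \<Rightarrow> - y + x)) \<in> borel_measurable (baire \<Otimes>\<^sub>M baire)"
  proof (rule borel_measurable_LIMSEQ_real[OF _ m])
    fix q :: "'g \<times> 'g"
    obtain x y where q: "q = (x, y)" by force
    have "(\<lambda>n. u (- s n y + x)) \<longlonglongrightarrow> u (- y + x)"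
    proof (rule metric_tendsto_imp_tendsto)
      show "(\<lambda>n. inverse (real (Suc n))) \<longlonglongrightarrow> 0" by (rule LIMSEQ_inverse_real_of_nat)
      show "\<forall>\<^sub>F n in sequentially. dist (u (- s n y + x)) (u (- y + x)) \<le> dist (inverse (real (Suc n))) 0"
        using s(3)[of y x] by (intro always_eventually allI) (simp add: dist_commute less_imp_le)
    qed
    then show "(\<lambda>n. case q of (x, y) \<Rightarrow> u (- s n y + x)) \<longlonglongrightarrow> u (case q of (x, y) \<Rightarrow> - y + x)"
      by (simp add: q)
  qed
qed

section \<open>Haar measure and its Baire part\<close>

locale compact_haar =
  fixes M :: "'g::{topological_ab_group_add, t2_space} measure"
  assumes compact_UNIV: "compact (UNIV :: 'g set)"
    and haar: "haar_prob_measure M"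
begin

lemma sets_M [simp, measurable_cong]: "sets M = sets borel"
  using haar by (simp add: haar_prob_measure_def)

lemma space_M [simp]: "space M = UNIV"
  using sets_eq_imp_space_eq[OF sets_M] by simp

lemma emeasure_UNIV [simp]: "emeasure M UNIV = 1"
  using haar by (simp add: haar_prob_measure_def)

sublocale finite_measure M
  by (rule finite_measureI) simp

text \<open>The restriction of the Haar measure to the Baire sets, written as an image under the
  identity so that integrals and null sets are compared by change of variables.\<close>

definition baire_part :: "'g measure" where "baire_part = distr M baire (\<lambda>x. x)"

lemma sets_baire_part [simp, measurable_cong]: "sets baire_part = sets baire"
  by (simp add: baire_part_def)

lemma space_baire_part [simp]: "space baire_part = UNIV"
  by (simp add: baire_part_def)

lemma id_measurable_baire [measurable]: "(\<lambda>x. x) \<in> measurable M baire"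
proof -
  have "(\<lambda>x. x) \<in> measurable borel (baire :: 'g measure)"
    using sets_baire_subset_borel by (auto simp: measurable_def)
  then show ?thesis by (simp cong: measurable_cong_sets)
qed

lemma baire_measurable_imp_measurable:
  "f \<in> measurable baire X \<Longrightarrow> f \<in> measurable M X"
  using measurable_compose[OF id_measurable_baire] by simp

lemma emeasure_baire_part: "A \<in> sets baire \<Longrightarrow> emeasure baire_part A = emeasure M A"
  by (simp add: baire_part_def emeasure_distr)

lemma emeasure_baire_part_UNIV [simp]: "emeasure baire_part UNIV = 1"
  using emeasure_baire_part[of UNIV] sets.top[of baire] by simp

sublocale baire_part: finite_measure baire_part
  by (rule finite_measureI) simp

sublocale baire_part_pair: pair_sigma_finite baire_part baire_part ..

lemma continuous_imp_measurable:
  "continuous_on UNIV (f :: 'g \<Rightarrow> 'b::topological_space) \<Longrightarrow> f \<in> borel_measurable M"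
  by (simp cong: measurable_cong_sets add: borel_measurable_continuous_onI)

lemma translate_measurable [measurable]: "(\<lambda>x. a + x) \<in> measurable M M"
  and translate_measurable_baire [measurable]: "(\<lambda>x. a + x) \<in> measurable baire baire"
  and uminus_measurable [measurable]: "uminus \<in> measurable M M"
  and uminus_measurable_baire [measurable]: "uminus \<in> measurable baire (baire :: 'g measure)"
proof -
  have *: "continuous_on UNIV (\<lambda>x. a + x)" "continuous_on UNIV (uminus :: 'g \<Rightarrow> 'g)"
    by (auto intro!: continuous_intros)
  show "(\<lambda>x. a + x) \<in> measurable M M" "uminus \<in> measurable M M"
    using *[THEN continuous_imp_measurable] by (simp_all cong: measurable_cong_sets)
  show "(\<lambda>x. a + x) \<in> measurable baire baire" "uminus \<in> measurable baire (baire :: 'g measure)"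
    using *[THEN continuous_imp_measurable_baire_baire] by simp_all
qed

lemma minus_plus_measurable [measurable]: "(\<lambda>y. - y + x) \<in> measurable M M"
  and minus_plus_measurable_baire [measurable]: "(\<lambda>y. - y + x :: 'g) \<in> measurable baire baire"
proof -
  have "(\<lambda>y. - y + x) = (\<lambda>y. x + - y)" by (simp add: fun_eq_iff)
  then show "(\<lambda>y. - y + x) \<in> measurable M M" "(\<lambda>y. - y + x :: 'g) \<in> measurable baire baire"
    using measurable_compose[OF uminus_measurable translate_measurable[of x]]
      measurable_compose[OF uminus_measurable_baire translate_measurable_baire[of x]]
    by (simp_all only:)
qed

lemma minus_plus_measurable_pair [measurable]: "(\<lambda>(x, y). - y + x :: 'g) \<in> measurable (baire \<Otimes>\<^sub>M baire) baire"
  by (rule measurable_minus_plus_baire[OF compact_UNIV])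

section \<open>Translation invariance and comparison of the two integrals\<close>

lemma emeasure_translate: "A \<in> sets M \<Longrightarrow> emeasure M ((+) a ` A) = emeasure M A"
  using haar[unfolded haar_prob_measure_def, THEN conjunct2, THEN conjunct2, THEN conjunct1] by simp

lemma emeasure_eq_INF_open: "A \<in> sets M \<Longrightarrow> emeasure M A = (INF U\<in>{U. A \<subseteq> U \<and> open U}. emeasure M U)"
  using haar[unfolded haar_prob_measure_def, THEN conjunct2, THEN conjunct2, THEN conjunct2, THEN conjunct1]
  unfolding sets_M by (rule bspec)

lemma emeasure_eq_SUP_compact: "open U \<Longrightarrow> emeasure M U = (SUP K\<in>{K. K \<subseteq> U \<and> compact K}. emeasure M K)"
  using haar[unfolded haar_prob_measure_def, THEN conjunct2, THEN conjunct2, THEN conjunct2, THEN conjunct2]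
  by (elim allE impE)

lemma distr_translate: "distr M M (\<lambda>x. a + x) = M"
proof (rule measure_eqI)
  fix A assume "A \<in> sets (distr M M (\<lambda>x. a + x))"
  then have A: "A \<in> sets M" by simp
  have "(\<lambda>x. a + x) -` A = (+) (- a) ` A"
    by (auto intro: image_eqI[of _ _ "a + _"])
  then show "emeasure (distr M M (\<lambda>x. a + x)) A = emeasure M A"
    using emeasure_translate[of A "- a"] A by (simp only: emeasure_distr[OF translate_measurable A] space_M Int_UNIV_right)
qed simp

lemma nn_integral_translate: "f \<in> borel_measurable M \<Longrightarrow> (\<integral>\<^sup>+x. f (a + x) \<partial>M) = (\<integral>\<^sup>+x. f x \<partial>M)"
  using nn_integral_distr[of "\<lambda>x. a + x" M M f] by (simp add: distr_translate)

lemma integral_translate: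
  fixes f :: "'g \<Rightarrow> 'b::{banach, second_countable_topology}"
  shows "f \<in> borel_measurable M \<Longrightarrow> (\<integral>x. f (a + x) \<partial>M) = (\<integral>x. f x \<partial>M)"
  using integral_distr[of "\<lambda>x. a + x" M M f] by (simp add: distr_translate)

lemma AE_translate:
  assumes "AE x in M. P x"
  shows "AE x in M. P (a + x)"
proof (rule AE_distrD[OF translate_measurable])
  show "AE x in distr M M (\<lambda>x. a + x). P x"
    using assms by (simp only: distr_translate)
qed

lemma nn_integral_baire_part: "f \<in> borel_measurable baire \<Longrightarrow> (\<integral>\<^sup>+x. f x \<partial>baire_part) = (\<integral>\<^sup>+x. f x \<partial>M)"
  unfolding baire_part_def by (subst nn_integral_distr) auto

lemma integral_baire_part:
  fixes f :: "'g \<Rightarrow> 'b::{banach, second_countable_topology}"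
  shows "f \<in> borel_measurable baire \<Longrightarrow> (\<integral>x. f x \<partial>baire_part) = (\<integral>x. f x \<partial>M)"
  unfolding baire_part_def by (subst integral_distr) auto

lemma AE_baire_part_imp_AE_M: "AE x in baire_part. P x \<Longrightarrow> AE x in M. P x"
  unfolding baire_part_def by (drule AE_distrD[rotated]) auto

section \<open>Regularity and Baire representatives\<close>

lemma outer_regular:
  assumes "A \<in> sets M" "e > 0"
  obtains U where "open U" "A \<subseteq> U" "emeasure M U < emeasure M A + ennreal e"
proof -
  note eq = emeasure_eq_INF_open[OF assms(1)]
  have "(INF U\<in>{U. A \<subseteq> U \<and> open U}. emeasure M U) < emeasure M A + ennreal e"
    unfolding eq[symmetric] using assms(2)
    by (simp add: emeasure_eq_measure ennreal_less_iff flip: ennreal_plus)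
  then show thesis
    unfolding INF_less_iff using that by blast
qed

lemma inner_regular:
  assumes "open U" "e > 0"
  obtains K where "compact K" "K \<subseteq> U" "emeasure M U < emeasure M K + ennreal e"
proof -
  note eq = emeasure_eq_SUP_compact[OF assms(1)]
  have "\<exists>K\<in>{K. K \<subseteq> U \<and> compact K}. (SUP K\<in>{K. K \<subseteq> U \<and> compact K}. emeasure M K) < emeasure M K + ennreal e"
  proof (rule SUP_approx_ennreal[OF _ _ refl])
    show "(SUP K\<in>{K. K \<subseteq> U \<and> compact K}. emeasure M K) \<noteq> \<infinity>"
      unfolding eq[symmetric] by simp
  qed (use assms(2) in auto)
  then show thesis
    unfolding eq[symmetric] using that by blast
qed

text \<open>Wherever \<open>u\<close> differs from the indicator of \<open>A\<close>, the point lies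
  in \<open>U - A\<close> or in \<open>U - K\<close>: outside \<open>U\<close> both functions
  vanish, and on \<open>A \<inter> K\<close> both are 1.\<close>

lemma continuous_approx_indicator:
  assumes A: "A \<in> sets M" and e: "e > 0"
  obtains u :: "'g \<Rightarrow> real" where "continuous_on UNIV u" "\<And>x. 0 \<le> u x" "\<And>x. u x \<le> 1"
    "(\<integral>\<^sup>+x. ennreal \<bar>indicator A x - u x\<bar> \<partial>M) \<le> ennreal e"
proof -
  obtain U where U: "open U" "A \<subseteq> U" "emeasure M U < emeasure M A + ennreal (e/2)"
    by (rule outer_regular[OF A half_gt_zero[OF e]]) (rule that)
  \<comment> \<open>Inner regularity is available for open sets, so \<open>K\<close> exhausts
    \<open>U\<close> and need not lie in \<open>A\<close>.\<close>
  obtain K where K: "compact K" "K \<subseteq> U" "emeasure M U < emeasure M K + ennreal (e/2)"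
    by (rule inner_regular[OF U(1) half_gt_zero[OF e]]) (rule that)
  have sets: "A \<in> sets M" "U \<in> sets M" "K \<in> sets M"
    using A U(1) K(1) by (auto intro: borel_compact)
  obtain u :: "'g \<Rightarrow> real" where u: "continuous_on UNIV u" "\<And>x. 0 \<le> u x" "\<And>x. u x \<le> 1"
      "\<And>x. x \<in> K \<Longrightarrow> u x = 1" "\<And>x. x \<notin> U \<Longrightarrow> u x = 0"
    by (rule urysohn_compact_UNIV[OF compact_UNIV compact_imp_closed[OF K(1)] U(1) K(2)]) (rule that)
  have diff: "emeasure M (U - B) \<le> ennreal (e/2)" if "B \<subseteq> U" "B \<in> sets M" "emeasure M U < emeasure M B + ennreal (e/2)" for B
  proof -
    have "emeasure M (U - B) = emeasure M U - emeasure M B"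
      using that sets by (intro emeasure_Diff) auto
    also have "\<dots> \<le> ennreal (e/2)"
      using that(3) by (simp add: add.commute ennreal_minus_le_iff less_imp_le)
    finally show ?thesis .
  qed
  have "(\<integral>\<^sup>+x. ennreal \<bar>indicator A x - u x\<bar> \<partial>M) \<le> (\<integral>\<^sup>+x. indicator (U - A) x + indicator (U - K) x \<partial>M)"
  proof (rule nn_integral_mono)
    fix x
    have "\<bar>indicator A x - u x\<bar> \<le> indicator (U - A) x + indicator (U - K) x"
      using u(2,3)[of x] u(4,5)[of x] U(2) K(2) by (auto simp: indicator_def split: if_splits)
    then have "ennreal \<bar>indicator A x - u x\<bar> \<le> ennreal (indicator (U - A) x + indicator (U - K) x)"
      by (rule ennreal_leI)
    then show "ennreal \<bar>indicator A x - u x\<bar> \<le> indicator (U - A) x + indicator (U - K) x"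
      by (simp add: ennreal_plus ennreal_indicator)
  qed
  also have "\<dots> = emeasure M (U - A) + emeasure M (U - K)"
    using sets by (subst nn_integral_add) auto
  also have "\<dots> \<le> ennreal (e/2) + ennreal (e/2)"
    using diff U K sets by (intro add_mono) auto
  also have "\<dots> = ennreal e"
    using e by (simp flip: ennreal_plus)
  finally show thesis using u that by blast
qed

text \<open>The errors \<open>(1/2)^n\<close> have a finite sum, so the sum of the pointwise
  differences has finite integral and is finite almost everywhere. Hence the continuous functions
  \<open>u n\<close> converge almost everywhere to the indicator, and their \<open>lim\<close> is
  Baire measurable.\<close>

lemma AE_eq_baire_indicator:
  assumes A: "A \<in> sets M"
  obtains h :: "'g \<Rightarrow> real" where "h \<in> borel_measurable baire" "AE x in M. indicator A x = h x"
proof -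
  have "\<exists>u :: 'g \<Rightarrow> real. continuous_on UNIV u \<and> (\<integral>\<^sup>+x. ennreal \<bar>indicator A x - u x\<bar> \<partial>M) \<le> ennreal ((1/2)^n)" for n
    by (rule continuous_approx_indicator[OF A, of "(1/2)^n"]) auto
  then obtain u :: "nat \<Rightarrow> 'g \<Rightarrow> real" where u: "\<And>n. continuous_on UNIV (u n)"
      "\<And>n. (\<integral>\<^sup>+x. ennreal \<bar>indicator A x - u n x\<bar> \<partial>M) \<le> ennreal ((1/2)^n)"
    by metis
  have [measurable]: "u n \<in> borel_measurable baire" for n
    by (intro continuous_real_imp_measurable_baire u)
  note [measurable] = A
  have "(\<integral>\<^sup>+x. (\<Sum>n. ennreal \<bar>indicator A x - u n x\<bar>) \<partial>M) = (\<Sum>n. \<integral>\<^sup>+x. ennreal \<bar>indicator A x - u n x\<bar> \<partial>M)"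
    by (rule nn_integral_suminf) auto
  also have "\<dots> \<le> (\<Sum>n. ennreal ((1/2)^n))"
    by (intro suminf_le u) auto
  also have "\<dots> = ennreal (\<Sum>n. (1/2)^n)"
    by (intro suminf_ennreal2) (auto intro: summable_geometric)
  also have "\<dots> < \<infinity>" by simp
  finally have "AE x in M. (\<Sum>n. ennreal \<bar>indicator A x - u n x\<bar>) \<noteq> \<infinity>"
    by (intro nn_integral_PInf_AE) auto
  then have "AE x in M. indicator A x = lim (\<lambda>n. u n x)"
  proof eventually_elim
    case (elim x)
    then have "summable (\<lambda>n. \<bar>indicator A x - u n x\<bar>)"
      by (intro summable_suminf_not_top) auto
    then have "(\<lambda>n. \<bar>indicator A x - u n x\<bar>) \<longlonglongrightarrow> 0"
      by (rule summable_LIMSEQ_zero)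
    then have "(\<lambda>n. indicator A x - u n x) \<longlonglongrightarrow> 0"
      by (rule tendsto_rabs_zero_cancel)
    then have "(\<lambda>n. indicator A x - (indicator A x - u n x)) \<longlonglongrightarrow> indicator A x - 0"
      by (intro tendsto_diff tendsto_const)
    then have "(\<lambda>n. u n x) \<longlonglongrightarrow> indicator A x" by simp
    then show ?case by (simp add: limI)
  qed
  then show thesis by (intro that[of "\<lambda>x. lim (\<lambda>n. u n x)"]) auto
qed

lemma simple_function_sum:
  fixes s :: "'g \<Rightarrow> 'b::real_vector"
  assumes "finite (range s)"
  shows "s x = (\<Sum>y\<in>range s. indicator (s -` {y}) x *\<^sub>R y)"
proof -
  have "(\<Sum>y\<in>range s. indicator (s -` {y}) x *\<^sub>R y) = (\<Sum>y\<in>range s. if y = s x then y else 0)"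
    by (intro sum.cong) (auto simp: indicator_def)
  then show ?thesis using assms by (simp add: sum.delta)
qed

text \<open>A simple function combines finitely many indicators, and a measurable function is the
  limit of a sequence of simple functions; the countably many exceptional sets have a null
  union.\<close>

lemma AE_eq_baire_measurable:
  fixes f :: "'g \<Rightarrow> 'b::{banach, second_countable_topology}"
  assumes f: "f \<in> borel_measurable M"
  obtains h where "h \<in> borel_measurable baire" "AE x in M. f x = h x"
proof -
  have simple: "\<exists>h\<in>borel_measurable baire. AE x in M. s x = h x" if s: "simple_function M s" for s :: "'g \<Rightarrow> 'b"
  proof -
    have fin: "finite (range s)" using s by (simp add: simple_function_def)
    have meas: "s -` {y} \<in> sets M" for y
      using simple_functionD(2)[OF s, of "{y}"] by simp
    have "\<exists>h :: 'g \<Rightarrow> real. h \<in> borel_measurable baire \<and> (AE x in M. indicator (s -` {y}) x = h x)" for y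
      using AE_eq_baire_indicator[OF meas] by metis
    then obtain h :: "'b \<Rightarrow> 'g \<Rightarrow> real" where h: "\<And>y. h y \<in> borel_measurable baire"
        "\<And>y. AE x in M. indicator (s -` {y}) x = h y x"
      by metis
    have "AE x in M. \<forall>y\<in>range s. indicator (s -` {y}) x = h y x"
      using fin h(2) by (intro AE_finite_allI) auto
    then have "AE x in M. s x = (\<Sum>y\<in>range s. h y x *\<^sub>R y)"
    proof eventually_elim
      case (elim x)
      then show ?case by (subst simple_function_sum[OF fin]) (auto intro!: sum.cong)
    qed
    moreover have "(\<lambda>x. \<Sum>y\<in>range s. h y x *\<^sub>R y) \<in> borel_measurable baire"
      using h(1) by measurable
    ultimately show ?thesis by auto
  qed
  obtain F where F: "\<And>i. simple_function M (F i)" "\<And>x. x \<in> space M \<Longrightarrow> (\<lambda>i. F i x) \<longlonglongrightarrow> f x"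
    using borel_measurable_implies_sequence_metric[OF f, of 0] by metis
  obtain h where h: "\<And>i. h i \<in> borel_measurable baire" "\<And>i. AE x in M. F i x = h i x"
    using simple[OF F(1)] by metis
  have "AE x in M. \<forall>i. F i x = h i x"
    using h(2) by (simp add: AE_all_countable)
  then have "AE x in M. f x = lim (\<lambda>i. h i x)"
  proof eventually_elim
    case (elim x)
    then show ?case using F(2)[of x] by (simp add: limI)
  qed
  moreover have "(\<lambda>x. lim (\<lambda>i. h i x)) \<in> borel_measurable baire"
    using h(1) by measurable
  ultimately show thesis using that by blast
qed

text \<open>
  Integrating \<open>indicator A (x - y)\<close> over \<open>x\<close> gives the measure of \<open>A\<close>, over \<open>y\<close> that of \<open>- A\<close>.
\<close>

lemma emeasure_uminus_baire:
  assumes A[measurable]: "A \<in> sets baire"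
  shows "emeasure M (uminus -` A) = emeasure M A"
proof -
  have m[measurable]: "(\<lambda>(x, y). indicator A (- y + x) :: ennreal) \<in> borel_measurable (baire \<Otimes>\<^sub>M baire)"
    using measurable_compose[OF minus_plus_measurable_pair borel_measurable_indicator[OF A]]
    by (simp only: case_prod_beta')
  have [measurable]: "(indicator A :: 'g \<Rightarrow> ennreal) \<in> borel_measurable M"
    by (rule baire_measurable_imp_measurable) measurable
  have [measurable]: "(uminus -` A) \<in> sets baire"
    using measurable_sets[OF uminus_measurable_baire A] by simp
  have 1: "(\<integral>\<^sup>+x. indicator A (- y + x) \<partial>baire_part) = emeasure M A" for y
  proof -
    have "(\<integral>\<^sup>+x. indicator A (- y + x) \<partial>baire_part) = (\<integral>\<^sup>+x. indicator A (- y + x) \<partial>M)"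
      by (rule nn_integral_baire_part) measurable
    also have "\<dots> = (\<integral>\<^sup>+x. indicator A x \<partial>M)"
      by (rule nn_integral_translate) measurable
    also have "\<dots> = emeasure M A"
      using A sets_baire_subset_borel by (intro nn_integral_indicator) auto
    finally show ?thesis .
  qed
  have 2: "(\<integral>\<^sup>+y. indicator A (- y + x) \<partial>baire_part) = emeasure M (uminus -` A)" for x
  proof -
    have "(\<integral>\<^sup>+y. indicator A (- y + x) \<partial>baire_part) = (\<integral>\<^sup>+y. indicator A (- y + x) \<partial>M)"
      by (rule nn_integral_baire_part) measurable
    also have "\<dots> = (\<integral>\<^sup>+y. indicator A (- (x + y) + x) \<partial>M)"
      by (rule nn_integral_translate[symmetric]) measurable
    also have "\<dots> = (\<integral>\<^sup>+y. indicator (uminus -` A) y \<partial>M)"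
      by (simp add: indicator_def algebra_simps)
    also have "\<dots> = emeasure M (uminus -` A)"
      using \<open>(uminus -` A) \<in> sets baire\<close> sets_baire_subset_borel by (intro nn_integral_indicator) auto
    finally show ?thesis .
  qed
  have "(\<integral>\<^sup>+y. (\<integral>\<^sup>+x. indicator A (- y + x) \<partial>baire_part) \<partial>baire_part) = (\<integral>\<^sup>+x. (\<integral>\<^sup>+y. indicator A (- y + x) \<partial>baire_part) \<partial>baire_part)"
    by (rule baire_part_pair.Fubini') (use m in measurable)
  then show ?thesis
    by (simp only: 1 2 nn_integral_const space_baire_part emeasure_baire_part_UNIV mult_1_right)
qed

text \<open>For compact \<open>K\<close> inside the reflection of \<open>U\<close>, a Urysohn
  function provides a Baire set \<open>D\<close> between the reflection of \<open>K\<close> and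
  \<open>U\<close>, to which invariance on Baire sets applies. Inner regularity of the reflected
  open set gives the bound.\<close>

lemma emeasure_uminus_open:
  assumes U: "open U"
  shows "emeasure M (uminus -` U) \<le> emeasure M U"
proof -
  have c: "continuous_on UNIV (uminus :: 'g \<Rightarrow> 'g)" by (intro continuous_intros)
  have "open (uminus -` U)"
    using U c by (simp add: continuous_on_open_vimage)
  then have "emeasure M (uminus -` U) = (SUP K\<in>{K. K \<subseteq> uminus -` U \<and> compact K}. emeasure M K)"
    by (rule emeasure_eq_SUP_compact)
  also have "\<dots> \<le> emeasure M U"
  proof (rule SUP_least, clarify)
    fix K assume K: "K \<subseteq> uminus -` U" "compact K"
    have "compact (uminus ` K)"
      using K(2) c by (intro compact_continuous_image continuous_on_subset[OF c]) auto
    then obtain u :: "'g \<Rightarrow> real" where u: "continuous_on UNIV u"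
        "\<And>x. x \<in> uminus ` K \<Longrightarrow> u x = 1" "\<And>x. x \<notin> U \<Longrightarrow> u x = 0"
      using urysohn_compact_UNIV[OF compact_UNIV compact_imp_closed[of "uminus ` K"] U] K(1)
      by (metis image_subset_iff_subset_vimage)
    define D where "D = {x. 0 < u x}"
    have D: "D \<in> sets baire" unfolding D_def by (rule positive_set_baire[OF u(1)])
    then have D': "D \<in> sets M" "uminus -` D \<in> sets M"
      using sets_baire_subset_borel measurable_sets[OF uminus_measurable, of D] by auto
    have "K \<subseteq> uminus -` D" using u(2) by (auto simp: D_def)
    then have "emeasure M K \<le> emeasure M (uminus -` D)"
      using D' by (intro emeasure_mono)
    also have "\<dots> = emeasure M D" by (rule emeasure_uminus_baire[OF D])
    also have "\<dots> \<le> emeasure M U"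
      using U u(3) by (intro emeasure_mono) (force simp: D_def, simp)
    finally show "emeasure M K \<le> emeasure M U" .
  qed
  finally show ?thesis .
qed

text \<open>A null set has open neighbourhoods of arbitrarily small measure, and their reflections
  are no larger. This is what makes the convolution depend only on the class of its second
  factor.\<close>

lemma AE_uminus:
  assumes "AE x in M. P x"
  shows "AE x in M. P (- x)"
proof -
  obtain Z where Z: "Z \<in> sets M" "emeasure M Z = 0" "{x. \<not> P x} \<subseteq> Z"
    using AE_E[OF assms] by (metis (no_types, lifting) Collect_cong UNIV_I space_M)
  have "emeasure M (uminus -` Z) \<le> ennreal e" if e: "e > 0" for e
  proof -
    obtain U where U: "open U" "Z \<subseteq> U" "emeasure M U < emeasure M Z + ennreal e"
      using outer_regular[OF Z(1) e] by metis
    have "emeasure M (uminus -` Z) \<le> emeasure M (uminus -` U)"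
      using U(1,2) measurable_sets[OF uminus_measurable, of U] by (intro emeasure_mono) auto
    also have "\<dots> \<le> emeasure M U" by (rule emeasure_uminus_open[OF U(1)])
    finally show ?thesis using U(3) Z(2) by simp
  qed
  then have "emeasure M (uminus -` Z) \<le> 0"
    by (intro ennreal_le_epsilon[of 0]) auto
  then have "emeasure M (uminus -` Z) = 0"
    by simp
  moreover have "uminus -` Z \<in> sets M"
    using measurable_sets[OF uminus_measurable Z(1)] by simp
  ultimately show ?thesis
    using Z(3) by (intro AE_I[of _ _ "uminus -` Z"]) auto
qed

lemma AE_minus_plus:
  assumes "AE x in M. P x"
  shows "AE y in M. P (- y + x)"
  using AE_uminus[OF AE_translate[OF assms, of x]] by simp

end

section \<open>Complex scalars, characters of the algebra, and Jensen's inequality\<close>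

text \<open>Reduces complex scalars to real ones and the single bounded operator
  \<open>scaleC \<i>\<close>, which yields the measurability of scaling.\<close>

lemma scaleC_altdef: "scaleC c x = Re c *\<^sub>R x + Im c *\<^sub>R scaleC \<i> x"
proof -
  have "scaleC c x = scaleC (complex_of_real (Re c) + complex_of_real (Im c) * \<i>) x"
    using complex_eq[of c] by (simp add: mult.commute)
  then show ?thesis
    by (simp add: scaleC_add_left scaleR_eq_scaleC scaleC_scaleC)
qed

lemma scaleC_1 [simp]: "scaleC 1 x = x"
  using scaleR_eq_scaleC[of 1 x] by simp

lemma scaleC_scaleR: "scaleC c (r *\<^sub>R x) = r *\<^sub>R scaleC c x"
  by (simp add: scaleR_eq_scaleC scaleC_scaleC mult.commute)

lemma mult_scaleC_right: "x * scaleC c y = scaleC c (x * y)"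
  for x :: "'a::comm_complex_banach_algebra"
  by (metis mult.commute mult_scaleC_left)

lemma bounded_linear_scaleC_right: "bounded_linear (scaleC c)"
  by (rule bounded_linear_intro[of _ "cmod c"]) (simp_all add: scaleC_add_right scaleC_scaleR norm_scaleC)

lemma bounded_linear_scaleC_left: "bounded_linear (\<lambda>c. scaleC c x)"
  by (rule bounded_linear_intro[of _ "norm x"])
    (simp_all add: scaleC_add_left scaleR_eq_scaleC[of _ "scaleC _ _"] scaleC_scaleC scaleR_conv_of_real norm_scaleC mult.commute)

lemma scaleC_0_left [simp]: "scaleC 0 x = 0"
  using linear_0[OF bounded_linear.linear[OF bounded_linear_scaleC_left]] .

lemma borel_measurable_scaleC [measurable]:
  fixes g :: "'x \<Rightarrow> 'a::{comm_complex_banach_algebra, second_countable_topology}"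
  assumes [measurable]: "f \<in> borel_measurable X" "g \<in> borel_measurable X"
  shows "(\<lambda>x. scaleC (f x) (g x)) \<in> borel_measurable X"
proof -
  have [measurable]: "(\<lambda>x. scaleC \<i> (g x)) \<in> borel_measurable X"
    using borel_measurable_continuous_onI[OF linear_continuous_on[OF bounded_linear_scaleC_right[of \<i>]]]
    by (rule measurable_compose[OF assms(2)])
  show ?thesis
    by (subst scaleC_altdef) measurable
qed

text \<open>Scaling by a nonzero \<open>c\<close> is invertible, so the two integrands are
  integrable together, and otherwise both integrals are 0 by convention. For \<open>c = 0\<close>
  both sides vanish.\<close>

lemma integral_scaleC_right:
  fixes f :: "'x \<Rightarrow> 'a::{comm_complex_banach_algebra, second_countable_topology}"
  shows "(\<integral>x. scaleC c (f x) \<partial>X) = scaleC c (\<integral>x. f x \<partial>X)"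
proof (cases "c = 0")
  case False
  then show ?thesis
    by (intro integral_bounded_linear'[OF bounded_linear_scaleC_right bounded_linear_scaleC_right[of "inverse c"]])
      (simp add: scaleC_scaleC)
qed simp

section \<open>Characters of a commutative Banach algebra\<close>

lemma gelfand_spectrum_type_algebra_iff:
  "\<phi> \<in> gelfand_spectrum type_algebra \<longleftrightarrow>
     (\<forall>x y. \<phi> (x + y) = \<phi> x + \<phi> y) \<and> (\<forall>c x. \<phi> (scaleC c x) = c * \<phi> x) \<and>
     (\<forall>x y. \<phi> (x * y) = \<phi> x * \<phi> y) \<and> (\<exists>x. \<phi> x \<noteq> 0)"
  by (simp add: gelfand_spectrum_def type_algebra_def)

text \<open>
  If \<open>\<phi> a = 1\<close> and \<open>norm a < 1\<close>, then \<open>b = a + a\<^sup>2 + \<dots>\<close> satisfies \<open>b = a + a b\<close>, which \<open>\<phi>\<close>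
  maps to \<open>\<phi> b = 1 + \<phi> b\<close>.
\<close>

lemma gelfand_spectrum_type_algebra_norm_le:
  fixes \<phi> :: "'a::comm_complex_banach_algebra \<Rightarrow> complex"
  assumes "\<phi> \<in> gelfand_spectrum type_algebra"
  shows "cmod (\<phi> x) \<le> norm x"
proof (rule ccontr)
  assume less: "\<not> cmod (\<phi> x) \<le> norm x"
  then have "cmod (\<phi> x) > 0" by (metis norm_ge_zero not_le order.strict_trans1)
  then have nz: "\<phi> x \<noteq> 0" by simp
  have \<phi>: "\<phi> (x + y) = \<phi> x + \<phi> y" "\<phi> (scaleC c x) = c * \<phi> x" "\<phi> (x * y) = \<phi> x * \<phi> y" for x y c
    using assms by (auto simp: gelfand_spectrum_type_algebra_iff)
  define a where "a = scaleC (inverse (\<phi> x)) x"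
  have "\<phi> a = 1" using nz by (simp add: a_def \<phi>)
  have "norm a = norm x / cmod (\<phi> x)"
    by (simp add: a_def norm_scaleC norm_inverse divide_inverse mult.commute)
  then have a: "norm a < 1"
    using less \<open>cmod (\<phi> x) > 0\<close> by (simp only: divide_less_eq_1_pos not_le)
  define P where "P n = ((*) a ^^ n) a" for n
  have P: "P 0 = a" "P (Suc n) = a * P n" for n
    by (simp_all add: P_def)
  have P_le: "norm (P n) \<le> norm a ^ n * norm a" for n
  proof (induction n)
    case (Suc n)
    have "norm (P (Suc n)) \<le> norm a * norm (P n)"
      by (simp add: P norm_mult_ineq)
    also have "\<dots> \<le> norm a * (norm a ^ n * norm a)"
      by (intro mult_left_mono Suc.IH) auto
    finally show ?case by simp
  qed (simp add: P)
  have sum: "summable P"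
  proof (rule summable_comparison_test')
    show "summable (\<lambda>n. norm a ^ n * norm a)"
      using a by (intro summable_mult2 summable_geometric) simp
  qed (rule P_le)
  define b where "b = suminf P"
  have "b = P 0 + (\<Sum>n. P (Suc n))"
    unfolding b_def by (subst suminf_split_head[OF sum]) simp
  also have "(\<Sum>n. P (Suc n)) = a * b"
    unfolding b_def P by (rule suminf_mult[OF sum])
  finally have "\<phi> b = \<phi> (a + a * b)" by (simp add: P)
  also have "\<dots> = 1 + \<phi> b" using \<open>\<phi> a = 1\<close> by (simp add: \<phi>)
  finally show False by simp
qed

lemma gelfand_spectrum_type_algebra_bounded_linear:
  fixes \<phi> :: "'a::comm_complex_banach_algebra \<Rightarrow> complex"
  assumes "\<phi> \<in> gelfand_spectrum type_algebra"
  shows "bounded_linear \<phi>"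
proof (rule bounded_linear_intro)
  show "norm (\<phi> x) \<le> norm x * 1" for x
    using gelfand_spectrum_type_algebra_norm_le[OF assms] by simp
qed (use assms in \<open>auto simp: gelfand_spectrum_type_algebra_iff scaleR_eq_scaleC scaleR_conv_of_real\<close>)

text \<open>The convex function \<open>t powr p\<close> lies above its tangent at \<open>c\<close>.
  This is Young's inequality for \<open>t\<close> and \<open>c powr (p - 1)\<close> with conjugate
  exponents \<open>p\<close> and \<open>q\<close>.\<close>

lemma powr_tangent_le:
  fixes c t p :: real
  assumes "p > 1" "c \<ge> 0" "t \<ge> 0"
  shows "p * c powr (p - 1) * t \<le> t powr p + (p - 1) * c powr p"
proof -
  define q where "q = p / (p - 1)"
  have q: "q > 1" "1 / p + 1 / q = 1" "(p - 1) * q = p"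
    using assms(1) by (simp_all add: q_def field_simps)
  have "t * c powr (p - 1) \<le> t powr p / p + (c powr (p - 1)) powr q / q"
    using assms q by (intro Youngs_inequality) auto
  also have "(c powr (p - 1)) powr q = c powr p"
    by (simp add: powr_powr q)
  finally have "p * (t * c powr (p - 1)) \<le> p * (t powr p / p + c powr p / q)"
    using assms(1) by (intro mult_left_mono) auto
  also have "\<dots> = t powr p + (p - 1) * c powr p"
    using assms(1) by (simp add: q_def field_simps)
  finally show ?thesis by (simp add: mult_ac)
qed

text \<open>The tangent inequality at \<open>c\<close> is integrated against the weight
  \<open>w\<close>, and the finite term \<open>(p - 1) * c powr p\<close> cancels. Since
  \<open>c\<close> is merely a lower bound for the weighted mean, the case of an infinite mean is
  covered.\<close>

lemma jensen_powr:
  fixes w t :: "'x \<Rightarrow> real"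
  assumes [measurable]: "w \<in> borel_measurable X" "t \<in> borel_measurable X"
    and w: "\<And>x. w x \<ge> 0" and t: "\<And>x. t x \<ge> 0" and p: "p > 1" and c: "c \<ge> 0"
    and mass: "(\<integral>\<^sup>+x. ennreal (w x) \<partial>X) \<le> 1"
    and le: "ennreal c \<le> (\<integral>\<^sup>+x. ennreal (w x * t x) \<partial>X)"
  shows "ennreal (c powr p) \<le> (\<integral>\<^sup>+x. ennreal (w x * t x powr p) \<partial>X)"
proof -
  let ?I = "\<integral>\<^sup>+x. ennreal (w x * t x powr p) \<partial>X"
  let ?k = "(p - 1) * c powr p" and ?d = "p * c powr (p - 1)"
  have d: "?d \<ge> 0" and k: "?k \<ge> 0" using p by auto
  have "ennreal (c powr p) + ennreal ?k = ennreal (?d * c)"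
  proof (cases "c = 0")
    case False
    then have "c powr p = c powr (p - 1) * c" using c by (simp add: powr_diff)
    then have "c powr p + ?k = ?d * c" by (simp add: algebra_simps)
    then show ?thesis using k by (simp flip: ennreal_plus)
  qed simp
  also have "\<dots> = ennreal ?d * ennreal c" using d c by (rule ennreal_mult)
  also have "\<dots> \<le> ennreal ?d * (\<integral>\<^sup>+x. ennreal (w x * t x) \<partial>X)"
    by (intro mult_left_mono le) auto
  also have "\<dots> = (\<integral>\<^sup>+x. ennreal ?d * ennreal (w x * t x) \<partial>X)"
    by (rule nn_integral_cmult[symmetric]) measurable
  also have "\<dots> \<le> (\<integral>\<^sup>+x. ennreal (w x * t x powr p) + ennreal ?k * ennreal (w x) \<partial>X)"
  proof (rule nn_integral_mono)
    fix x
    have "?d * (w x * t x) = w x * (?d * t x)" by simp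
    also have "\<dots> \<le> w x * (t x powr p + ?k)"
      by (intro mult_left_mono powr_tangent_le p c t w)
    finally have "?d * (w x * t x) \<le> w x * t x powr p + ?k * w x"
      by (simp add: algebra_simps)
    then have "ennreal (?d * (w x * t x)) \<le> ennreal (w x * t x powr p + ?k * w x)"
      by (rule ennreal_leI)
    then show "ennreal ?d * ennreal (w x * t x) \<le> ennreal (w x * t x powr p) + ennreal ?k * ennreal (w x)"
      using d k w t by (simp add: ennreal_mult ennreal_plus)
  qed
  also have "\<dots> = ?I + ennreal ?k * (\<integral>\<^sup>+x. ennreal (w x) \<partial>X)"
    by (subst nn_integral_add) (auto simp: nn_integral_cmult)
  also have "\<dots> \<le> ?I + ennreal ?k * 1"
    by (intro add_left_mono mult_left_mono mass) auto
  finally have "ennreal (c powr p) + ennreal ?k \<le> ?I + ennreal ?k" by simp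
  then show ?thesis by (simp add: add.commute[of _ "ennreal ?k"] ennreal_add_left_cancel_le)
qed

section \<open>Convolution and Young's inequality\<close>

context compact_haar
begin

lemma measurable_baire_part [simp]: "measurable baire_part X = measurable baire X"
  by (rule measurable_cong_sets[OF sets_baire_part refl])

lemma minus_measurable_baire [measurable]:
  "(\<lambda>y. y - x :: 'g) \<in> measurable baire baire" "(\<lambda>y. x - y :: 'g) \<in> measurable baire baire"
  "(\<lambda>(x, y). x - y :: 'g) \<in> measurable (baire \<Otimes>\<^sub>M baire) baire"
  using translate_measurable_baire[of "- x"] minus_plus_measurable_baire[of x] minus_plus_measurable_pair
  by simp_all

text \<open>The identity holds at every \<open>x\<close>: for each fixed \<open>x\<close> the
  integrand changes only on a null set, by \<open>AE_minus_plus\<close>. Iterated integrals can then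
  be taken over the Baire sigma-algebra.\<close>

lemma convolution_baire:
  fixes f g :: "'g \<Rightarrow> 'a::{comm_complex_banach_algebra, second_countable_topology}"
  assumes [measurable]: "f \<in> borel_measurable M" "g \<in> borel_measurable M"
    and [measurable]: "f0 \<in> borel_measurable baire" "g0 \<in> borel_measurable baire"
    and f: "AE x in M. f x = f0 x" and g: "AE x in M. g x = g0 x"
  shows "convolution M f g x = (\<integral>y. f0 y * g0 (- y + x) \<partial>baire_part)"
proof -
  have "convolution M f g x = (\<integral>y. f0 y * g0 (- y + x) \<partial>M)"
    unfolding convolution_def
  proof (rule integral_cong_AE)
    show "AE y in M. f y * g (- y + x) = f0 y * g0 (- y + x)"
      using f AE_minus_plus[OF g, of x] by eventually_elim simp
  qed measurable
  also have "\<dots> = (\<integral>y. f0 y * g0 (- y + x) \<partial>baire_part)"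
    by (rule integral_baire_part[symmetric]) measurable
  finally show ?thesis .
qed

lemma convolution_cong_AE:
  fixes f g :: "'g \<Rightarrow> 'a::{comm_complex_banach_algebra, second_countable_topology}"
  assumes [measurable]: "f \<in> borel_measurable M" "g \<in> borel_measurable M" "f' \<in> borel_measurable M" "g' \<in> borel_measurable M"
    and f: "AE x in M. f x = f' x" and g: "AE x in M. g x = g' x"
  shows "convolution M f g x = convolution M f' g' x"
  unfolding convolution_def
proof (rule integral_cong_AE)
  show "AE y in M. f y * g (- y + x) = f' y * g' (- y + x)"
    using f AE_minus_plus[OF g, of x] by eventually_elim simp
qed measurable

lemma borel_measurable_baire_convolution:
  fixes f g :: "'g \<Rightarrow> 'a::{comm_complex_banach_algebra, second_countable_topology}"
  assumes [measurable]: "f \<in> borel_measurable M" "g \<in> borel_measurable M"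
  shows "convolution M f g \<in> borel_measurable baire"
proof -
  obtain f0 where [measurable]: "f0 \<in> borel_measurable baire" and f: "AE x in M. f x = f0 x"
    using AE_eq_baire_measurable[OF assms(1)] by metis
  obtain g0 where [measurable]: "g0 \<in> borel_measurable baire" and g: "AE x in M. g x = g0 x"
    using AE_eq_baire_measurable[OF assms(2)] by metis
  have "(\<lambda>x. \<integral>y. f0 y * g0 (- y + x) \<partial>baire_part) \<in> borel_measurable baire"
    by measurable
  then show ?thesis
    using convolution_baire[OF assms _ _ f g] by (simp add: fun_eq_iff cong: measurable_cong)
qed

lemma borel_measurable_convolution [measurable]:
  fixes f g :: "'g \<Rightarrow> 'a::{comm_complex_banach_algebra, second_countable_topology}"
  assumes "f \<in> borel_measurable M" "g \<in> borel_measurable M"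
  shows "convolution M f g \<in> borel_measurable M"
  using borel_measurable_baire_convolution[OF assms] by (rule baire_measurable_imp_measurable)

text \<open>Tonelli, followed by translation invariance of the inner integral. It serves Young's
  inequality, the almost everywhere finiteness of a majorant, and the multiplicativity of the
  character tensors.\<close>

lemma nn_integral_convolution_kernel:
  fixes F G :: "'g \<Rightarrow> ennreal"
  assumes [measurable]: "F \<in> borel_measurable baire" "G \<in> borel_measurable baire"
  shows "(\<integral>\<^sup>+x. (\<integral>\<^sup>+y. F y * G (- y + x) \<partial>baire_part) \<partial>baire_part) = (\<integral>\<^sup>+x. F x \<partial>baire_part) * (\<integral>\<^sup>+x. G x \<partial>baire_part)"
proof -
  have "(\<integral>\<^sup>+x. (\<integral>\<^sup>+y. F y * G (- y + x) \<partial>baire_part) \<partial>baire_part) = (\<integral>\<^sup>+y. (\<integral>\<^sup>+x. F y * G (- y + x) \<partial>baire_part) \<partial>baire_part)"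
    by (rule baire_part_pair.Fubini'[symmetric]) measurable
  also have "\<dots> = (\<integral>\<^sup>+y. F y * (\<integral>\<^sup>+x. G x \<partial>baire_part) \<partial>baire_part)"
  proof (rule nn_integral_cong)
    fix y
    have "(\<integral>\<^sup>+x. G (- y + x) \<partial>M) = (\<integral>\<^sup>+x. G x \<partial>M)"
      by (rule nn_integral_translate) measurable
    then have eq: "(\<integral>\<^sup>+x. G (- y + x) \<partial>baire_part) = (\<integral>\<^sup>+x. G x \<partial>baire_part)"
      by (subst (1 2) nn_integral_baire_part) simp_all
    have "(\<integral>\<^sup>+x. F y * G (- y + x) \<partial>baire_part) = F y * (\<integral>\<^sup>+x. G (- y + x) \<partial>baire_part)"
      using measurable_compose[OF translate_measurable_baire assms(2)] by (intro nn_integral_cmult) simp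
    then show "(\<integral>\<^sup>+x. F y * G (- y + x) \<partial>baire_part) = F y * (\<integral>\<^sup>+x. G x \<partial>baire_part)"
      by (simp only: eq)
  qed
  also have "\<dots> = (\<integral>\<^sup>+x. F x \<partial>baire_part) * (\<integral>\<^sup>+x. G x \<partial>baire_part)"
    by (rule nn_integral_multc) (simp add: assms)
  finally show ?thesis .
qed

lemma nn_integral_norm_eq_baire:
  assumes [measurable]: "f \<in> borel_measurable M" "h \<in> borel_measurable baire" "F \<in> borel_measurable borel"
    and "AE x in M. f x = h x"
  shows "(\<integral>\<^sup>+x. F (f x) \<partial>M) = (\<integral>\<^sup>+x. F (h x) \<partial>baire_part)"
proof -
  have "(\<integral>\<^sup>+x. F (f x) \<partial>M) = (\<integral>\<^sup>+x. F (h x) \<partial>M)"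
    using assms(4) by (intro nn_integral_cong_AE) auto
  then show ?thesis by (subst nn_integral_baire_part) auto
qed

text \<open>With L^1 norm at most 1, \<open>norm (f y)\<close> is a weight of mass at most 1. Jensen
  bounds the p-th power of the convolution by a convolution of this weight with the p-th power of
  \<open>norm g\<close>. In this normalised form the inequality iterates over convolution powers
  without growing constants.\<close>

lemma young_inequality:
  fixes f g :: "'g \<Rightarrow> 'a::{comm_complex_banach_algebra, second_countable_topology}"
  assumes [measurable]: "f \<in> borel_measurable M" "g \<in> borel_measurable M"
    and f1: "(\<integral>\<^sup>+x. ennreal (norm (f x)) \<partial>M) \<le> 1" and p: "p > 1"
  shows "(\<integral>\<^sup>+x. ennreal (norm (convolution M f g x) powr p) \<partial>M) \<le> (\<integral>\<^sup>+x. ennreal (norm (g x) powr p) \<partial>M)"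
proof -
  obtain f0 where f0[measurable]: "f0 \<in> borel_measurable baire" and f: "AE x in M. f x = f0 x"
    using AE_eq_baire_measurable[OF assms(1)] by metis
  obtain g0 where g0[measurable]: "g0 \<in> borel_measurable baire" and g: "AE x in M. g x = g0 x"
    using AE_eq_baire_measurable[OF assms(2)] by metis
  note conv = convolution_baire[OF assms(1,2) f0 g0 f g]
  have mass: "(\<integral>\<^sup>+x. ennreal (norm (f0 x)) \<partial>baire_part) \<le> 1"
    using f1 nn_integral_norm_eq_baire[OF assms(1) f0 _ f, of "\<lambda>a. ennreal (norm a)"] by simp
  have "(\<integral>\<^sup>+x. ennreal (norm (convolution M f g x) powr p) \<partial>M) = (\<integral>\<^sup>+x. ennreal (norm (\<integral>y. f0 y * g0 (- y + x) \<partial>baire_part) powr p) \<partial>baire_part)"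
    unfolding conv by (rule nn_integral_baire_part[symmetric]) measurable
  also have "\<dots> \<le> (\<integral>\<^sup>+x. (\<integral>\<^sup>+y. ennreal (norm (f0 y)) * ennreal (norm (g0 (- y + x)) powr p) \<partial>baire_part) \<partial>baire_part)"
  proof (rule nn_integral_mono)
    fix x
    \<comment> \<open>If the integrand is not integrable, its integral is 0 by convention and the
      bound is trivial.\<close>
    have le: "ennreal (norm (\<integral>y. f0 y * g0 (- y + x) \<partial>baire_part)) \<le> (\<integral>\<^sup>+y. ennreal (norm (f0 y) * norm (g0 (- y + x))) \<partial>baire_part)"
    proof (cases "integrable baire_part (\<lambda>y. f0 y * g0 (- y + x))")
      case True
      then have "ennreal (norm (\<integral>y. f0 y * g0 (- y + x) \<partial>baire_part)) \<le> (\<integral>\<^sup>+y. ennreal (norm (f0 y * g0 (- y + x))) \<partial>baire_part)"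
        by (rule integral_norm_bound_ennreal)
      also have "\<dots> \<le> (\<integral>\<^sup>+y. ennreal (norm (f0 y) * norm (g0 (- y + x))) \<partial>baire_part)"
        by (intro nn_integral_mono ennreal_leI norm_mult_ineq)
      finally show ?thesis .
    qed (simp add: not_integrable_integral_eq)
    have "ennreal (norm (\<integral>y. f0 y * g0 (- y + x) \<partial>baire_part) powr p) \<le> (\<integral>\<^sup>+y. ennreal (norm (f0 y) * norm (g0 (- y + x)) powr p) \<partial>baire_part)"
      by (rule jensen_powr[OF _ _ _ _ p _ mass le]) simp_all
    then show "ennreal (norm (\<integral>y. f0 y * g0 (- y + x) \<partial>baire_part) powr p) \<le> (\<integral>\<^sup>+y. ennreal (norm (f0 y)) * ennreal (norm (g0 (- y + x)) powr p) \<partial>baire_part)"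
      by (simp add: ennreal_mult)
  qed
  also have "\<dots> = (\<integral>\<^sup>+x. ennreal (norm (f0 x)) \<partial>baire_part) * (\<integral>\<^sup>+x. ennreal (norm (g0 x) powr p) \<partial>baire_part)"
    by (rule nn_integral_convolution_kernel) measurable
  also have "\<dots> \<le> 1 * (\<integral>\<^sup>+x. ennreal (norm (g0 x) powr p) \<partial>baire_part)"
    by (intro mult_right_mono mass) auto
  also have "\<dots> = (\<integral>\<^sup>+x. ennreal (norm (g x) powr p) \<partial>M)"
    using nn_integral_norm_eq_baire[OF assms(2) g0 _ g, of "\<lambda>a. ennreal (norm a powr p)"] by simp
  finally show ?thesis .
qed

end

section \<open>Automatic continuity\<close>

lemma scaleC_minus_1 [simp]: "scaleC (-1) x = - x"
  using scaleR_eq_scaleC[of "-1" x] by simp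

text \<open>Where the norms are not summable the right-hand side is infinite, so the bound also
  covers points at which the series diverges and its sum is arbitrary.\<close>

lemma ennreal_norm_suminf_le:
  fixes h :: "nat \<Rightarrow> 'a::banach"
  shows "ennreal (norm (\<Sum>n. h n)) \<le> (\<Sum>n. ennreal (norm (h n)))"
proof (cases "(\<Sum>n. ennreal (norm (h n))) = top")
  case False
  then have "summable (\<lambda>n. norm (h n))"
    by (intro summable_suminf_not_top) auto
  then show ?thesis
    by (subst suminf_ennreal2) (auto intro: ennreal_leI summable_norm)
qed simp

lemma powr_add_le:
  fixes a b p :: real
  assumes "a \<ge> 0" "b \<ge> 0" "p \<ge> 0"
  shows "(a + b) powr p \<le> 2 powr p * (a powr p + b powr p)"
proof -
  have "(a + b) powr p \<le> (2 * max a b) powr p"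
    using assms by (intro powr_mono2) auto
  also have "\<dots> = 2 powr p * max a b powr p"
    by (rule powr_mult)
  also have "\<dots> \<le> 2 powr p * (a powr p + b powr p)"
    by (intro mult_left_mono) (auto simp: max_def)
  finally show ?thesis .
qed

context compact_haar
begin

section \<open>Membership in L^p\<close>

lemma Lp_functions_measurable: "f \<in> Lp_functions M p \<Longrightarrow> f \<in> borel_measurable M"
  by (simp add: Lp_functions_def)

lemma Lp_functions_cong_AE:
  assumes "f \<in> Lp_functions M p" "g \<in> borel_measurable M" "AE x in M. f x = g x"
  shows "g \<in> Lp_functions M p"
proof -
  have "(\<integral>\<^sup>+x. ennreal (norm (f x) powr p) \<partial>M) = (\<integral>\<^sup>+x. ennreal (norm (g x) powr p) \<partial>M)"
    using assms(3) by (intro nn_integral_cong_AE) auto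
  then show ?thesis using assms by (simp add: Lp_functions_def)
qed

lemma Lp_functions_bounded:
  assumes "f \<in> borel_measurable M" "\<And>x. norm (f x) \<le> k" "p \<ge> 0"
  shows "f \<in> Lp_functions M p"
proof -
  have "(\<integral>\<^sup>+x. ennreal (norm (f x) powr p) \<partial>M) \<le> (\<integral>\<^sup>+x. ennreal (k powr p) \<partial>M)"
    by (intro nn_integral_mono ennreal_leI powr_mono2 assms) auto
  also have "\<dots> < \<infinity>" by simp
  finally show ?thesis using assms by (simp add: Lp_functions_def)
qed

lemma Lp_functions_add:
  assumes "f \<in> Lp_functions M p" "g \<in> Lp_functions M p" "p \<ge> 0"
  shows "(\<lambda>x. f x + g x) \<in> Lp_functions M p"
proof -
  have [measurable]: "f \<in> borel_measurable M" "g \<in> borel_measurable M"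
    using assms by (auto simp: Lp_functions_def)
  have "(\<integral>\<^sup>+x. ennreal (norm (f x + g x) powr p) \<partial>M) \<le>
      (\<integral>\<^sup>+x. ennreal (2 powr p) * (ennreal (norm (f x) powr p) + ennreal (norm (g x) powr p)) \<partial>M)"
  proof (rule nn_integral_mono)
    fix x
    have "norm (f x + g x) powr p \<le> (norm (f x) + norm (g x)) powr p"
      using assms by (intro powr_mono2 norm_triangle_ineq) auto
    also have "\<dots> \<le> 2 powr p * (norm (f x) powr p + norm (g x) powr p)"
      using assms by (intro powr_add_le) auto
    finally show "ennreal (norm (f x + g x) powr p) \<le>
        ennreal (2 powr p) * (ennreal (norm (f x) powr p) + ennreal (norm (g x) powr p))"
      by (simp add: ennreal_leI flip: ennreal_mult ennreal_plus)
  qed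
  also have "\<dots> = ennreal (2 powr p) * ((\<integral>\<^sup>+x. ennreal (norm (f x) powr p) \<partial>M) + (\<integral>\<^sup>+x. ennreal (norm (g x) powr p) \<partial>M))"
    by (simp add: nn_integral_cmult nn_integral_add)
  also have "\<dots> < \<infinity>"
    using assms by (simp add: Lp_functions_def ennreal_mult_less_top)
  finally show ?thesis by (simp add: Lp_functions_def)
qed

lemma nn_integral_norm_scaleC_powr:
  assumes "f \<in> borel_measurable M"
  shows "(\<integral>\<^sup>+x. ennreal (norm (scaleC c (f x)) powr p) \<partial>M) =
    ennreal (cmod c powr p) * (\<integral>\<^sup>+x. ennreal (norm (f x) powr p) \<partial>M)"
  using assms by (simp add: norm_scaleC powr_mult ennreal_mult nn_integral_cmult)

lemma Lp_functions_scaleC: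
  fixes f :: "'g \<Rightarrow> 'a::{comm_complex_banach_algebra, second_countable_topology}"
  assumes "f \<in> Lp_functions M p"
  shows "(\<lambda>x. scaleC c (f x)) \<in> Lp_functions M p"
proof -
  have [measurable]: "f \<in> borel_measurable M"
    using assms by (auto simp: Lp_functions_def)
  show ?thesis
    using assms by (simp add: Lp_functions_def nn_integral_norm_scaleC_powr ennreal_mult_less_top)
qed

lemma Lp_functions_translate:
  assumes "f \<in> Lp_functions M p"
  shows "(\<lambda>x. f (a + x)) \<in> Lp_functions M p"
proof -
  have f: "f \<in> borel_measurable M"
    using assms by (auto simp: Lp_functions_def)
  then have "(\<integral>\<^sup>+x. ennreal (norm (f (a + x)) powr p) \<partial>M) = (\<integral>\<^sup>+x. ennreal (norm (f x) powr p) \<partial>M)"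
    by (intro nn_integral_translate[of "\<lambda>x. ennreal (norm (f x) powr p)"]) simp
  then show ?thesis
    using assms measurable_compose[OF translate_measurable f] by (simp add: Lp_functions_def)
qed

lemma Lp_functions_imp_integrable:
  fixes f :: "'g \<Rightarrow> 'a::{banach, second_countable_topology}"
  assumes "f \<in> Lp_functions M p" "p \<ge> 1"
  shows "integrable M f"
proof (rule integrableI_bounded)
  show [measurable]: "f \<in> borel_measurable M"
    using assms by (auto simp: Lp_functions_def)
  have le: "norm a \<le> 1 + norm a powr p" for a :: 'a
  proof (cases "norm a \<le> 1")
    case True
    then show ?thesis using powr_ge_zero[of "norm a" p] by linarith
  next
    case False
    then have "norm a powr 1 \<le> norm a powr p" using assms by (intro powr_mono) auto
    then show ?thesis using False by simp
  qed
  have "(\<integral>\<^sup>+x. ennreal (norm (f x)) \<partial>M) \<le> (\<integral>\<^sup>+x. 1 + ennreal (norm (f x) powr p) \<partial>M)"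
    by (intro nn_integral_mono) (metis le ennreal_1 ennreal_leI ennreal_plus powr_ge_zero zero_le_one)
  also have "\<dots> < \<infinity>"
    using assms by (subst nn_integral_add) (auto simp: Lp_functions_def)
  finally show "(\<integral>\<^sup>+x. ennreal (norm (f x)) \<partial>M) < \<infinity>" .
qed

text \<open>Jensen with the constant weight 1, which is admissible because the Haar measure has mass
  1.\<close>

lemma nn_integral_norm_le_1:
  fixes f :: "'g \<Rightarrow> 'a::{banach, second_countable_topology}"
  assumes f[measurable]: "f \<in> borel_measurable M" and le: "(\<integral>\<^sup>+x. ennreal (norm (f x) powr p) \<partial>M) \<le> 1" and p: "p > 1"
  shows "(\<integral>\<^sup>+x. ennreal (norm (f x)) \<partial>M) \<le> 1"
proof -
  have "f \<in> Lp_functions M p"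
    using le by (auto simp: Lp_functions_def intro: order.strict_trans1)
  then have int: "integrable M f"
    using p by (intro Lp_functions_imp_integrable) auto
  then have eq: "(\<integral>\<^sup>+x. ennreal (norm (f x)) \<partial>M) = ennreal (\<integral>x. norm (f x) \<partial>M)"
    by (intro nn_integral_eq_integral) auto
  have "ennreal ((\<integral>x. norm (f x) \<partial>M) powr p) \<le> (\<integral>\<^sup>+x. ennreal (1 * norm (f x) powr p) \<partial>M)"
    by (rule jensen_powr[OF _ _ _ _ p]) (simp_all add: eq)
  also have "\<dots> \<le> 1" using le by simp
  finally have "(\<integral>x. norm (f x) \<partial>M) powr p \<le> 1" by simp
  moreover have "1 powr p < (\<integral>x. norm (f x) \<partial>M) powr p" if "1 < (\<integral>x. norm (f x) \<partial>M)"
    using that p by (intro powr_less_mono2) auto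
  ultimately have "(\<integral>x. norm (f x) \<partial>M) \<le> 1"
    by (intro leI notI) simp
  then show ?thesis by (simp add: eq)
qed

lemma convolution_scaleC_left:
  fixes f g :: "'g \<Rightarrow> 'a::{comm_complex_banach_algebra, second_countable_topology}"
  shows "convolution M (\<lambda>x. scaleC c (f x)) g x = scaleC c (convolution M f g x)"
  by (simp add: convolution_def mult_scaleC_left integral_scaleC_right)

lemma Lp_functions_convolution:
  fixes f g :: "'g \<Rightarrow> 'a::{comm_complex_banach_algebra, second_countable_topology}"
  assumes f: "f \<in> Lp_functions M p" and g: "g \<in> Lp_functions M p" and p: "p > 1"
  shows "convolution M f g \<in> Lp_functions M p"
proof -
  have [measurable]: "f \<in> borel_measurable M" "g \<in> borel_measurable M"
    using assms by (auto simp: Lp_functions_def)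
  \<comment> \<open>The added 1 keeps the divisor positive when \<open>f\<close> vanishes almost
    everywhere.\<close>
  define k where "k = 1 + (\<integral>x. norm (f x) \<partial>M)"
  have k: "k > 0" "(\<integral>x. norm (f x) \<partial>M) \<le> k"
    by (auto simp: k_def intro: add_pos_nonneg)
  define h where "h x = scaleC (complex_of_real (1 / k)) (f x)" for x
  have int: "integrable M f"
    using f p by (intro Lp_functions_imp_integrable) auto
  have [measurable]: "h \<in> borel_measurable M" unfolding h_def by measurable
  have "(\<integral>\<^sup>+x. ennreal (norm (h x)) \<partial>M) = (\<integral>\<^sup>+x. ennreal (1 / k * norm (f x)) \<partial>M)"
    using k by (simp add: h_def norm_scaleC norm_divide)
  also have "\<dots> = ennreal (\<integral>x. 1 / k * norm (f x) \<partial>M)"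
    using k int by (intro nn_integral_eq_integral) auto
  also have "\<dots> \<le> 1"
    using k by (subst integral_mult_right_zero) (simp add: field_simps)
  finally have "(\<integral>\<^sup>+x. ennreal (norm (convolution M h g x) powr p) \<partial>M) \<le> (\<integral>\<^sup>+x. ennreal (norm (g x) powr p) \<partial>M)"
    by (intro young_inequality p) auto
  also have "\<dots> < \<infinity>" using g by (simp add: Lp_functions_def)
  finally have "convolution M h g \<in> Lp_functions M p"
    by (simp add: Lp_functions_def)
  then have "(\<lambda>x. scaleC (complex_of_real k) (convolution M h g x)) \<in> Lp_functions M p"
    by (rule Lp_functions_scaleC)
  also have "(\<lambda>x. scaleC (complex_of_real k) (convolution M h g x)) = convolution M f g"
    using k by (simp add: h_def[abs_def] convolution_scaleC_left scaleC_scaleC fun_eq_iff flip: of_real_mult)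
  finally show ?thesis .
qed

end

text \<open>The functional acts on functions instead of classes; \<open>cong_AE\<close> records that
  it factors through the quotient, so representatives never have to be chosen. Continuity is not
  among the assumptions but is derived.\<close>

locale Lp_functional = compact_haar M
  for M :: "'g::{topological_ab_group_add, t2_space} measure" +
  fixes p :: real and \<Psi> :: "('g \<Rightarrow> 'a::{comm_complex_banach_algebra, second_countable_topology}) \<Rightarrow> complex"
  assumes p: "p > 1"
    and cong_AE: "\<And>f g. f \<in> Lp_functions M p \<Longrightarrow> g \<in> Lp_functions M p \<Longrightarrow> AE x in M. f x = g x \<Longrightarrow> \<Psi> f = \<Psi> g"
    and add: "\<And>f g. f \<in> Lp_functions M p \<Longrightarrow> g \<in> Lp_functions M p \<Longrightarrow> \<Psi> (\<lambda>x. f x + g x) = \<Psi> f + \<Psi> g"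
    and scaleC: "\<And>c f. f \<in> Lp_functions M p \<Longrightarrow> \<Psi> (\<lambda>x. scaleC c (f x)) = c * \<Psi> f"
    and convolution: "\<And>f g. f \<in> Lp_functions M p \<Longrightarrow> g \<in> Lp_functions M p \<Longrightarrow> \<Psi> (convolution M f g) = \<Psi> f * \<Psi> g"
begin

text \<open>
  If \<open>c \<Psi> g = 1\<close> with \<open>cmod c < 1\<close>, then \<open>b = c g + c\<^sup>2 g * g + \<dots>\<close> lies in \<open>L\<^sup>p\<close> by Jensen's inequality
  for the geometric weights, and \<open>b = c g + c g * b\<close> almost everywhere, so that \<open>\<Psi> b = 1 + \<Psi> b\<close>.
\<close>

lemma norm_le_1_baire:
  assumes g[measurable]: "g \<in> borel_measurable baire" and le: "(\<integral>\<^sup>+x. ennreal (norm (g x) powr p) \<partial>M) \<le> 1"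
  shows "cmod (\<Psi> g) \<le> 1"
proof (rule ccontr)
  assume "\<not> cmod (\<Psi> g) \<le> 1"
  then have gt: "cmod (\<Psi> g) > 1" by simp
  define c where "c = inverse (\<Psi> g)"
  define r where "r = cmod c"
  have "\<Psi> g \<noteq> 0" using gt by auto
  then have r: "0 < r" "r < 1" and c: "c * \<Psi> g = 1"
    using gt by (auto simp: r_def c_def norm_inverse inverse_less_1_iff)
  \<comment> \<open>\<open>G n\<close> is the convolution power of order \<open>n + 1\<close>, which
    matches \<open>c ^ Suc n\<close> in \<open>S\<close>; there is no convolution unit to serve as
    the power of order 0.\<close>
  define G where "G n = (convolution M g ^^ n) g" for n
  have G: "G 0 = g" "G (Suc n) = convolution M g (G n)" for n
    by (simp_all add: G_def)
  have gM: "g \<in> borel_measurable M"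
    using g by (rule baire_measurable_imp_measurable)
  have G_baire[measurable]: "G n \<in> borel_measurable baire" for n
  proof (induction n)
    case (Suc n)
    then show ?case unfolding G
      by (intro borel_measurable_baire_convolution gM baire_measurable_imp_measurable)
  qed (simp add: G g)
  have GM: "G n \<in> borel_measurable M" for n
    using G_baire by (rule baire_measurable_imp_measurable)
  have g1: "(\<integral>\<^sup>+x. ennreal (norm (g x)) \<partial>M) \<le> 1"
    by (rule nn_integral_norm_le_1[OF gM le p])
  have Gp: "(\<integral>\<^sup>+x. ennreal (norm (G n x) powr p) \<partial>M) \<le> 1" for n
  proof (induction n)
    case (Suc n)
    have "(\<integral>\<^sup>+x. ennreal (norm (G (Suc n) x) powr p) \<partial>M) \<le> (\<integral>\<^sup>+x. ennreal (norm (G n x) powr p) \<partial>M)"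
      unfolding G by (rule young_inequality[OF gM GM g1 p])
    then show ?case using Suc.IH by (rule order_trans)
  qed (simp add: G le)
  have G1: "(\<integral>\<^sup>+x. ennreal (norm (G n x)) \<partial>M) \<le> 1" for n
    by (rule nn_integral_norm_le_1[OF GM Gp p])
  define S where "S n x = scaleC (c ^ Suc n) (G n x)" for n x
  have norm_S: "norm (S n x) = r ^ Suc n * norm (G n x)" for n x
    by (simp add: S_def norm_scaleC norm_mult norm_power r_def)
  have S_baire[measurable]: "S n \<in> borel_measurable baire" for n
    unfolding S_def by measurable
  define B where "B x = (\<Sum>n. ennreal (norm (S n x)))" for x
  define b where "b x = (\<Sum>n. S n x)" for x
  have b_baire[measurable]: "b \<in> borel_measurable baire"
    unfolding b_def by measurable
  have B_baire[measurable]: "B \<in> borel_measurable baire"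
    unfolding B_def by measurable
  have bM: "b \<in> borel_measurable M"
    using b_baire by (rule baire_measurable_imp_measurable)

  have geometric: "(\<Sum>n. ennreal ((1 - r) * r ^ n)) = 1"
  proof -
    have "(\<lambda>n. (1 - r) * r ^ n) sums ((1 - r) * (1 / (1 - r)))"
      using r by (intro sums_mult geometric_sums) auto
    then show ?thesis
      using r by (subst suminf_ennreal2) (auto simp: sums_iff)
  qed

  have "b \<in> Lp_functions M p"
  proof -
    \<comment> \<open>Jensen over the counting measure on the naturals, with the weights
      \<open>(1 - r) * r ^ n\<close> of total mass 1. The norm of \<open>S n x\<close> carries one
      further factor \<open>r\<close>, which is dropped.\<close>
    have pointwise: "ennreal (((1 - r) * norm (b x)) powr p) \<le> (\<Sum>n. ennreal ((1 - r) * r ^ n * norm (G n x) powr p))" for x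
    proof -
      have "ennreal ((1 - r) * norm (b x)) = ennreal (1 - r) * ennreal (norm (b x))"
        using r by (simp add: ennreal_mult)
      also have "\<dots> \<le> ennreal (1 - r) * (\<Sum>n. ennreal (norm (S n x)))"
        unfolding b_def by (intro mult_left_mono ennreal_norm_suminf_le) auto
      also have "\<dots> = (\<Sum>n. ennreal (1 - r) * ennreal (norm (S n x)))"
        by simp
      also have "\<dots> \<le> (\<Sum>n. ennreal ((1 - r) * r ^ n * norm (G n x)))"
      proof (intro suminf_le)
        fix n
        have "(1 - r) * norm (S n x) = r * ((1 - r) * r ^ n * norm (G n x))"
          by (simp add: norm_S)
        also have "\<dots> \<le> 1 * ((1 - r) * r ^ n * norm (G n x))"
          using r by (intro mult_right_mono) auto
        finally show "ennreal (1 - r) * ennreal (norm (S n x)) \<le> ennreal ((1 - r) * r ^ n * norm (G n x))"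
          using r by (simp add: ennreal_leI flip: ennreal_mult)
      qed auto
      finally have "ennreal ((1 - r) * norm (b x)) \<le> (\<integral>\<^sup>+n. ennreal ((1 - r) * r ^ n * norm (G n x)) \<partial>count_space UNIV)"
        by (simp add: nn_integral_count_space_nat)
      then have "ennreal (((1 - r) * norm (b x)) powr p) \<le> (\<integral>\<^sup>+n. ennreal ((1 - r) * r ^ n * norm (G n x) powr p) \<partial>count_space UNIV)"
        using r by (intro jensen_powr[OF _ _ _ _ p]) (simp_all add: nn_integral_count_space_nat geometric)
      then show ?thesis by (simp add: nn_integral_count_space_nat)
    qed
    have "(\<integral>\<^sup>+x. ennreal (((1 - r) * norm (b x)) powr p) \<partial>M) \<le>
        (\<integral>\<^sup>+x. (\<Sum>n. ennreal ((1 - r) * r ^ n * norm (G n x) powr p)) \<partial>M)"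
      by (intro nn_integral_mono pointwise)
    also have "\<dots> = (\<Sum>n. \<integral>\<^sup>+x. ennreal ((1 - r) * r ^ n * norm (G n x) powr p) \<partial>M)"
      using GM by (intro nn_integral_suminf) measurable
    also have "\<dots> \<le> (\<Sum>n. ennreal ((1 - r) * r ^ n))"
    proof (intro suminf_le)
      fix n
      have "(\<integral>\<^sup>+x. ennreal ((1 - r) * r ^ n * norm (G n x) powr p) \<partial>M) =
          ennreal ((1 - r) * r ^ n) * (\<integral>\<^sup>+x. ennreal (norm (G n x) powr p) \<partial>M)"
        using r GM by (subst nn_integral_cmult[symmetric]) (auto simp: ennreal_mult)
      also have "\<dots> \<le> ennreal ((1 - r) * r ^ n) * 1"
        by (intro mult_left_mono Gp) auto
      finally show "(\<integral>\<^sup>+x. ennreal ((1 - r) * r ^ n * norm (G n x) powr p) \<partial>M) \<le> ennreal ((1 - r) * r ^ n)"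
        by simp
    qed auto
    also have "\<dots> < \<infinity>" by (simp add: geometric)
    finally have "(\<lambda>x. scaleC (complex_of_real (1 - r)) (b x)) \<in> Lp_functions M p"
      using r bM by (simp add: Lp_functions_def norm_scaleC del: of_real_diff)
    then have "(\<lambda>x. scaleC (complex_of_real (inverse (1 - r))) (scaleC (complex_of_real (1 - r)) (b x))) \<in> Lp_functions M p"
      by (rule Lp_functions_scaleC)
    then show ?thesis
      using r by (simp add: scaleC_scaleC del: of_real_inverse of_real_diff flip: of_real_mult)
  qed

  have intB: "(\<integral>\<^sup>+x. B x \<partial>M) < \<infinity>"
  proof -
    have "(\<integral>\<^sup>+x. B x \<partial>M) = (\<Sum>n. \<integral>\<^sup>+x. ennreal (norm (S n x)) \<partial>M)"
      unfolding B_def using baire_measurable_imp_measurable[OF S_baire] by (intro nn_integral_suminf) measurable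
    also have "\<dots> \<le> (\<Sum>n. ennreal (r ^ n))"
    proof (intro suminf_le)
      fix n
      have "(\<integral>\<^sup>+x. ennreal (norm (S n x)) \<partial>M) = ennreal (r ^ Suc n) * (\<integral>\<^sup>+x. ennreal (norm (G n x)) \<partial>M)"
        using r GM unfolding norm_S by (subst nn_integral_cmult[symmetric]) (auto simp: ennreal_mult)
      also have "\<dots> \<le> ennreal (r ^ n) * 1"
        using r by (intro mult_mono G1 ennreal_leI power_decreasing) auto
      finally show "(\<integral>\<^sup>+x. ennreal (norm (S n x)) \<partial>M) \<le> ennreal (r ^ n)" by simp
    qed auto
    also have "\<dots> < \<infinity>"
      using r by (subst suminf_ennreal2) (auto intro: summable_geometric)
    finally show ?thesis .
  qed

  \<comment> \<open>Finiteness of this integral at \<open>x\<close> is what permits exchanging sum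
    and integral in \<open>convolution M g b x\<close>.\<close>
  have "AE x in baire_part. (\<integral>\<^sup>+y. ennreal (norm (g y)) * B (- y + x) \<partial>baire_part) \<noteq> \<infinity>"
  proof (rule nn_integral_PInf_AE)
    have m: "(\<lambda>(x, y). ennreal (norm (g y)) * B (- y + x)) \<in> borel_measurable (baire \<Otimes>\<^sub>M baire)"
      by measurable
    show "(\<lambda>x. \<integral>\<^sup>+y. ennreal (norm (g y)) * B (- y + x) \<partial>baire_part) \<in> borel_measurable baire_part"
      using m by (simp cong: measurable_cong_sets del: uminus_add_conv_diff) measurable
    have "(\<integral>\<^sup>+x. (\<integral>\<^sup>+y. ennreal (norm (g y)) * B (- y + x) \<partial>baire_part) \<partial>baire_part) = (\<integral>\<^sup>+x. ennreal (norm (g x)) \<partial>baire_part) * (\<integral>\<^sup>+x. B x \<partial>baire_part)"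
      by (rule nn_integral_convolution_kernel) auto
    also have "\<dots> = (\<integral>\<^sup>+x. ennreal (norm (g x)) \<partial>M) * (\<integral>\<^sup>+x. B x \<partial>M)"
      by (subst (1 2) nn_integral_baire_part) auto
    also have "\<dots> < \<infinity>"
      using intB order.strict_trans1[OF g1, of top] by (simp add: ennreal_mult_less_top)
    finally show "(\<integral>\<^sup>+x. (\<integral>\<^sup>+y. ennreal (norm (g y)) * B (- y + x) \<partial>baire_part) \<partial>baire_part) \<noteq> \<infinity>" by simp
  qed
  then have fin: "AE x in M. (\<integral>\<^sup>+y. ennreal (norm (g y)) * B (- y + x) \<partial>baire_part) \<noteq> \<infinity>"
    by (rule AE_baire_part_imp_AE_M)
  have finB: "AE x in M. B x \<noteq> \<infinity>"
    using intB baire_measurable_imp_measurable[OF B_baire] by (intro nn_integral_PInf_AE) auto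

  have eq: "AE x in M. b x = scaleC c (g x) + scaleC c (convolution M g b x)"
    using fin finB
  proof eventually_elim
    case (elim x)
    define H where "H n y = g y * S n (- y + x)" for n y
    have H_baire[measurable]: "H n \<in> borel_measurable baire" for n
      unfolding H_def by measurable
    have normH: "ennreal (norm (H n y)) \<le> ennreal (norm (g y)) * ennreal (norm (S n (- y + x)))" for n y
      unfolding H_def by (simp add: norm_mult_ineq ennreal_leI flip: ennreal_mult)
    have sumH: "(\<Sum>n. ennreal (norm (H n y))) \<le> ennreal (norm (g y)) * B (- y + x)" for y
      unfolding B_def ennreal_suminf_cmult[symmetric] by (intro suminf_le normH) auto
    have "(\<integral>\<^sup>+y. (\<Sum>n. ennreal (norm (H n y))) \<partial>baire_part) \<le> (\<integral>\<^sup>+y. ennreal (norm (g y)) * B (- y + x) \<partial>baire_part)"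
      by (intro nn_integral_mono sumH)
    also have "\<dots> < \<infinity>" using elim(1) by (simp add: less_top)
    finally have fin2: "(\<integral>\<^sup>+y. (\<Sum>n. ennreal (norm (H n y))) \<partial>baire_part) < \<infinity>" .
    then have fin3: "(\<Sum>n. \<integral>\<^sup>+y. ennreal (norm (H n y)) \<partial>baire_part) < \<infinity>"
      by (subst (asm) nn_integral_suminf) auto
    have int: "integrable baire_part (H n)" for n
    proof (rule integrableI_bounded)
      have "(\<integral>\<^sup>+y. ennreal (norm (H n y)) \<partial>baire_part) \<le> (\<Sum>n. \<integral>\<^sup>+y. ennreal (norm (H n y)) \<partial>baire_part)"
        using sum_le_suminf[of "\<lambda>n. \<integral>\<^sup>+y. ennreal (norm (H n y)) \<partial>baire_part" "{n}"] by simp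
      then show "(\<integral>\<^sup>+y. ennreal (norm (H n y)) \<partial>baire_part) < \<infinity>"
        using fin3 by (rule order.strict_trans1)
    qed simp
    have "AE y in baire_part. (\<Sum>n. ennreal (norm (H n y))) \<noteq> \<infinity>"
      using fin2 by (intro nn_integral_PInf_AE) auto
    then have sumN: "AE y in baire_part. summable (\<lambda>n. norm (H n y))"
      by eventually_elim (auto intro: summable_suminf_not_top)
    have "(\<Sum>n. ennreal (\<integral>y. norm (H n y) \<partial>baire_part)) < \<infinity>"
      using fin3 int by (subst (asm) nn_integral_eq_integral) auto
    then have sumI: "summable (\<lambda>n. \<integral>y. norm (H n y) \<partial>baire_part)"
      by (intro summable_suminf_not_top) auto
    have convG: "(\<integral>y. H n y \<partial>baire_part) = scaleC (c ^ Suc n) (G (Suc n) x)" for n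
    proof -
      have "(\<integral>y. H n y \<partial>baire_part) = (\<integral>y. scaleC (c ^ Suc n) (g y * G n (- y + x)) \<partial>M)"
        unfolding integral_baire_part[OF H_baire] by (simp only: H_def[abs_def] S_def mult_scaleC_right)
      then show ?thesis
        by (simp add: integral_scaleC_right G convolution_def)
    qed
    \<comment> \<open>A finite product leaves two cases: either \<open>g y = 0\<close> and both
      sides vanish, or \<open>B (- y + x)\<close> is finite and the series for \<open>b\<close>
      converges absolutely.\<close>
    have "AE y in baire_part. ennreal (norm (g y)) * B (- y + x) \<noteq> \<infinity>"
      using elim(1) by (intro nn_integral_PInf_AE) auto
    then have AEb: "AE y in baire_part. (\<Sum>n. H n y) = g y * b (- y + x)"
    proof eventually_elim
      case (elim y)
      show ?case
      proof (cases "g y = 0")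
        case False
        then have "B (- y + x) \<noteq> \<infinity>"
          using elim by (auto simp: ennreal_mult_eq_top_iff)
        then have "summable (\<lambda>n. norm (S n (- y + x)))"
          unfolding B_def by (intro summable_suminf_not_top) auto
        then show ?thesis
          unfolding H_def b_def by (rule suminf_mult[OF summable_norm_cancel])
      qed (simp add: H_def)
    qed
    have "convolution M g b x = (\<integral>y. g y * b (- y + x) \<partial>baire_part)"
      unfolding convolution_def by (rule integral_baire_part[symmetric]) measurable
    also have "\<dots> = (\<integral>y. (\<Sum>n. H n y) \<partial>baire_part)"
      using AEb by (intro integral_cong_AE) (auto elim: eventually_mono)
    also have "\<dots> = (\<Sum>n. \<integral>y. H n y \<partial>baire_part)"
      by (rule integral_suminf[OF int sumN sumI])
    finally have conv: "convolution M g b x = (\<Sum>n. scaleC (c ^ Suc n) (G (Suc n) x))"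
      by (simp only: convG)
    have sumG: "summable (\<lambda>n. scaleC (c ^ Suc n) (G (Suc n) x))"
      using summable_integral[OF int sumN sumI] by (simp only: convG)
    have "summable (\<lambda>n. norm (S n x))"
      using elim(2) unfolding B_def by (intro summable_suminf_not_top) auto
    then have sumS: "summable (\<lambda>n. S n x)"
      by (rule summable_norm_cancel)
    have "b x = S 0 x + (\<Sum>n. S (Suc n) x)"
      unfolding b_def by (subst suminf_split_head[OF sumS]) simp
    also have "(\<Sum>n. S (Suc n) x) = (\<Sum>n. scaleC c (scaleC (c ^ Suc n) (G (Suc n) x)))"
      by (simp add: S_def scaleC_scaleC)
    also have "\<dots> = scaleC c (convolution M g b x)"
      unfolding conv by (rule bounded_linear.suminf[OF bounded_linear_scaleC_right sumG, symmetric])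
    finally show ?case by (simp add: S_def G)
  qed

  have gL: "g \<in> Lp_functions M p"
    using le gM by (auto simp: Lp_functions_def intro: order.strict_trans1)
  have bL: "b \<in> Lp_functions M p" by fact
  note convL = Lp_functions_convolution[OF gL bL p]
  have "\<Psi> b = \<Psi> (\<lambda>x. scaleC c (g x) + scaleC c (convolution M g b x))"
    using p by (intro cong_AE[OF bL _ eq] Lp_functions_add Lp_functions_scaleC gL convL) auto
  also have "\<dots> = \<Psi> (\<lambda>x. scaleC c (g x)) + \<Psi> (\<lambda>x. scaleC c (convolution M g b x))"
    by (intro add Lp_functions_scaleC gL convL)
  also have "\<dots> = c * \<Psi> g + c * (\<Psi> g * \<Psi> b)"
    by (simp add: scaleC[OF gL] scaleC[OF convL] convolution[OF gL bL])
  also have "\<dots> = 1 + \<Psi> b" using c by (simp flip: mult.assoc)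
  finally show False by simp
qed

text \<open>Rescaling by \<open>1 / k\<close> and passing to a Baire representative reduce this to
  the unit ball.\<close>

lemma norm_le:
  assumes f[measurable]: "f \<in> borel_measurable M" and k: "k > 0"
    and le: "(\<integral>\<^sup>+x. ennreal (norm (f x) powr p) \<partial>M) \<le> ennreal (k powr p)"
  shows "cmod (\<Psi> f) \<le> k"
proof -
  obtain h where h[measurable]: "h \<in> borel_measurable baire" and fh: "AE x in M. f x = h x"
    using AE_eq_baire_measurable[OF f] by metis
  have hM: "h \<in> borel_measurable M" using h by (rule baire_measurable_imp_measurable)
  have fL: "f \<in> Lp_functions M p"
    using le by (auto simp: Lp_functions_def intro: order.strict_trans1)
  then have hL: "h \<in> Lp_functions M p"
    by (rule Lp_functions_cong_AE[OF _ hM fh])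
  let ?c = "complex_of_real (1 / k)"
  have "(\<integral>\<^sup>+x. ennreal (norm (h x) powr p) \<partial>M) = (\<integral>\<^sup>+x. ennreal (norm (f x) powr p) \<partial>M)"
    using fh by (intro nn_integral_cong_AE) auto
  then have "(\<integral>\<^sup>+x. ennreal (norm (scaleC ?c (h x)) powr p) \<partial>M) \<le> ennreal (cmod ?c powr p) * ennreal (k powr p)"
    unfolding nn_integral_norm_scaleC_powr[OF hM] using le by (intro mult_left_mono) auto
  also have "\<dots> = 1"
    using k by (simp add: norm_divide powr_divide flip: ennreal_mult)
  finally have "cmod (\<Psi> (\<lambda>x. scaleC ?c (h x))) \<le> 1"
    by (intro norm_le_1_baire) auto
  then have "cmod (\<Psi> h) \<le> k"
    using k by (simp add: scaleC[OF hL] norm_mult norm_divide field_simps)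
  then show ?thesis using cong_AE[OF fL hL fh] by simp
qed

text \<open>The total mass is 1, so a uniform bound is also a bound in L^p. The epsilon allows for
  \<open>k = 0\<close>, since \<open>norm_le\<close> asks for a positive bound.\<close>

lemma norm_le_sup:
  assumes f: "f \<in> borel_measurable M" and k: "k \<ge> 0" and le: "\<And>x. norm (f x) \<le> k"
  shows "cmod (\<Psi> f) \<le> k"
proof (rule field_le_epsilon)
  fix e :: real assume e: "e > 0"
  show "cmod (\<Psi> f) \<le> k + e"
  proof (rule norm_le[OF f])
    have "(\<integral>\<^sup>+x. ennreal (norm (f x) powr p) \<partial>M) \<le> (\<integral>\<^sup>+x. ennreal ((k + e) powr p) \<partial>M)"
      using e p by (intro nn_integral_mono ennreal_leI powr_mono2) (auto intro: order_trans[OF le])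
    then show "(\<integral>\<^sup>+x. ennreal (norm (f x) powr p) \<partial>M) \<le> ennreal ((k + e) powr p)" by simp
  qed (use k e in auto)
qed

lemma diff: "f \<in> Lp_functions M p \<Longrightarrow> g \<in> Lp_functions M p \<Longrightarrow> \<Psi> (\<lambda>x. f x - g x) = \<Psi> f - \<Psi> g"
  using add[OF _ Lp_functions_scaleC[of g p "-1"], of f] scaleC[of g "-1"] by simp

lemma sum:
  assumes "finite I" "\<And>i. i \<in> I \<Longrightarrow> f i \<in> Lp_functions M p"
  shows "\<Psi> (\<lambda>x. \<Sum>i\<in>I. f i x) = (\<Sum>i\<in>I. \<Psi> (f i))"
proof -
  have zeroL: "(\<lambda>x. 0) \<in> Lp_functions M p"
    using p by (intro Lp_functions_bounded[of _ 0]) auto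
  have zero: "\<Psi> (\<lambda>x. 0) = 0"
    using scaleC[OF zeroL, of 0] by simp
  have "(\<lambda>x. \<Sum>i\<in>I. f i x) \<in> Lp_functions M p \<and> ?thesis"
    using assms
  proof (induction I)
    case (insert i I)
    then show ?case
      using p by (auto simp: add intro: Lp_functions_add)
  qed (simp add: zero zeroL)
  then show ?thesis by simp
qed

text \<open>Continuity makes the kernel of \<open>\<Psi>\<close> closed in L^p; distances are
  measured by the p-th power of the norm.\<close>

lemma eq_0I:
  assumes fL: "f \<in> Lp_functions M p"
    and approx: "\<And>e. e > 0 \<Longrightarrow> \<exists>h\<in>Lp_functions M p. \<Psi> h = 0 \<and> (\<integral>\<^sup>+x. ennreal (norm (f x - h x) powr p) \<partial>M) \<le> ennreal e"
  shows "\<Psi> f = 0"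
proof -
  have "cmod (\<Psi> f) \<le> 0 + k" if k: "k > 0" for k :: real
  proof -
    obtain h where h: "h \<in> Lp_functions M p" "\<Psi> h = 0"
        "(\<integral>\<^sup>+x. ennreal (norm (f x - h x) powr p) \<partial>M) \<le> ennreal (k powr p)"
      using approx[of "k powr p"] k by auto
    have "cmod (\<Psi> (\<lambda>x. f x - h x)) \<le> k"
      using h fL by (intro norm_le k borel_measurable_diff Lp_functions_measurable)
    then show ?thesis using diff[OF fL h(1)] h(2) by simp
  qed
  then have "cmod (\<Psi> f) \<le> 0" by (rule field_le_epsilon)
  then show ?thesis by simp
qed

text \<open>The functions \<open>u x *\<^sub>R a\<close> span a dense subspace of L^p. If
  \<open>\<Psi>\<close> annihilated them all, closedness of its kernel would extend this to
  indicators times vectors, to simple functions, and by dominated convergence to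
  \<open>f\<close>.\<close>

lemma ex_continuous_nonzero:
  assumes nz: "f \<in> Lp_functions M p" "\<Psi> f \<noteq> 0"
  obtains u a where "continuous_on UNIV (u :: 'g \<Rightarrow> real)" "\<Psi> (\<lambda>x. u x *\<^sub>R a) \<noteq> 0"
proof (rule ccontr)
  note witness = that
  assume "\<not> thesis"
  then have zero: "\<Psi> (\<lambda>x. u x *\<^sub>R a) = 0" if "continuous_on UNIV u" for u :: "'g \<Rightarrow> real" and a
    using that witness[of u a] by blast
  have ind: "\<Psi> (\<lambda>x. indicator A x *\<^sub>R a) = 0" and indL: "(\<lambda>x. indicator A x *\<^sub>R a) \<in> Lp_functions M p"
    if A[measurable]: "A \<in> sets M" for A a
  proof -
    show L: "(\<lambda>x. indicator A x *\<^sub>R a) \<in> Lp_functions M p"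
      using p by (intro Lp_functions_bounded[of _ "norm a"]) (auto simp: indicator_def)
    show "\<Psi> (\<lambda>x. indicator A x *\<^sub>R a) = 0"
    proof (rule eq_0I[OF L])
      fix e :: real assume e: "e > 0"
      \<comment> \<open>The added 1 keeps the denominator positive when
        \<open>a = 0\<close>.\<close>
      define d where "d = e / (norm a powr p + 1)"
      have d: "d > 0" "norm a powr p * d \<le> e"
        using e powr_ge_zero[of "norm a" p] by (auto simp: d_def field_simps add_pos_nonneg intro: add_nonneg_pos)
      obtain u :: "'g \<Rightarrow> real" where u: "continuous_on UNIV u" "\<And>x. 0 \<le> u x" "\<And>x. u x \<le> 1"
          "(\<integral>\<^sup>+x. ennreal \<bar>indicator A x - u x\<bar> \<partial>M) \<le> ennreal d"
        using continuous_approx_indicator[OF A d(1)] by metis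
      have [measurable]: "u \<in> borel_measurable M" by (rule continuous_imp_measurable[OF u(1)])
      have uL: "(\<lambda>x. u x *\<^sub>R a) \<in> Lp_functions M p"
        using p u by (intro Lp_functions_bounded[of _ "norm a"]) (auto intro: mult_left_le_one_le)
      have "(\<integral>\<^sup>+x. ennreal (norm (indicator A x *\<^sub>R a - u x *\<^sub>R a) powr p) \<partial>M) \<le>
          (\<integral>\<^sup>+x. ennreal (norm a powr p) * ennreal \<bar>indicator A x - u x\<bar> \<partial>M)"
      proof (rule nn_integral_mono)
        fix x
        let ?t = "\<bar>indicator A x - u x\<bar>"
        have t: "?t \<le> 1" using u(2,3)[of x] by (auto simp: indicator_def)
        have "norm (indicator A x *\<^sub>R a - u x *\<^sub>R a) powr p = ?t powr p * norm a powr p"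
          by (simp add: powr_mult flip: scaleR_left_diff_distrib)
        \<comment> \<open>The difference is at most 1 in absolute value, so approximation in L^1 is
          already approximation in L^p.\<close>
        moreover have "?t powr p \<le> ?t"
        proof (cases "?t = 0")
          case False
          then have "?t powr p \<le> ?t powr 1" using t p by (intro powr_mono') auto
          then show ?thesis by simp
        qed simp
        then have "?t powr p * norm a powr p \<le> ?t * norm a powr p"
          by (rule mult_right_mono) simp
        ultimately have "norm (indicator A x *\<^sub>R a - u x *\<^sub>R a) powr p \<le> norm a powr p * ?t"
          by (simp only: mult.commute)
        then show "ennreal (norm (indicator A x *\<^sub>R a - u x *\<^sub>R a) powr p) \<le> ennreal (norm a powr p) * ennreal ?t"
          by (simp add: ennreal_leI flip: ennreal_mult)
      qed
      also have "\<dots> = ennreal (norm a powr p) * (\<integral>\<^sup>+x. ennreal \<bar>indicator A x - u x\<bar> \<partial>M)"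
        by (rule nn_integral_cmult) measurable
      also have "\<dots> \<le> ennreal (norm a powr p) * ennreal d"
        by (intro mult_left_mono u) auto
      also have "\<dots> \<le> ennreal e"
        using d by (simp add: ennreal_leI flip: ennreal_mult)
      finally show "\<exists>h\<in>Lp_functions M p. \<Psi> h = 0 \<and>
          (\<integral>\<^sup>+x. ennreal (norm (indicator A x *\<^sub>R a - h x) powr p) \<partial>M) \<le> ennreal e"
        using uL zero[OF u(1)] by blast
    qed
  qed
  have simple: "\<Psi> s = 0" "s \<in> Lp_functions M p" if s: "simple_function M s" for s
  proof -
    have fin: "finite (range s)" using s by (simp add: simple_function_def)
    have meas: "s -` {y} \<in> sets M" for y
      using simple_functionD(2)[OF s, of "{y}"] by simp
    have eq: "s = (\<lambda>x. \<Sum>y\<in>range s. indicator (s -` {y}) x *\<^sub>R y)"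
      using simple_function_sum[OF fin] by (rule ext)
    have "\<Psi> (\<lambda>x. \<Sum>y\<in>range s. indicator (s -` {y}) x *\<^sub>R y) = (\<Sum>y\<in>range s. \<Psi> (\<lambda>x. indicator (s -` {y}) x *\<^sub>R y))"
      using fin indL[OF meas] by (rule sum)
    also have "\<dots> = 0" by (simp add: ind[OF meas])
    finally show "\<Psi> s = 0" using eq by simp
    have "norm (s x) \<le> Max (norm ` range s)" for x
      using fin by (intro Max_ge) auto
    then show "s \<in> Lp_functions M p"
      using p by (intro Lp_functions_bounded borel_measurable_simple_function s) auto
  qed
  have fM[measurable]: "f \<in> borel_measurable M" using nz(1) by (rule Lp_functions_measurable)
  obtain F where F: "\<And>i. simple_function M (F i)" "\<And>x. x \<in> space M \<Longrightarrow> (\<lambda>i. F i x) \<longlonglongrightarrow> f x"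
      "\<And>i x. x \<in> space M \<Longrightarrow> dist (F i x) 0 \<le> 2 * dist (f x) 0"
    using borel_measurable_implies_sequence_metric[OF fM, of 0] by metis
  have [measurable]: "F i \<in> borel_measurable M" for i
    by (intro borel_measurable_simple_function F)
  have "(\<lambda>i. \<integral>\<^sup>+x. ennreal (norm (f x - F i x) powr p) \<partial>M) \<longlonglongrightarrow> (\<integral>\<^sup>+x. 0 \<partial>M)"
  proof (rule nn_integral_dominated_convergence)
    \<comment> \<open>The approximants satisfy \<open>norm (F i x) \<le> 2 * norm (f x)\<close>,
      hence the factor 3.\<close>
    show "AE x in M. ennreal (norm (f x - F i x) powr p) \<le> ennreal (3 powr p) * ennreal (norm (f x) powr p)" for i
    proof (rule AE_I2)
      fix x assume "x \<in> space M"
      then have "norm (f x - F i x) \<le> 3 * norm (f x)"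
        using F(3)[of x i] norm_triangle_ineq4[of "f x" "F i x"] by simp
      then have "norm (f x - F i x) powr p \<le> (3 * norm (f x)) powr p"
        using p by (intro powr_mono2) auto
      then show "ennreal (norm (f x - F i x) powr p) \<le> ennreal (3 powr p) * ennreal (norm (f x) powr p)"
        by (simp add: powr_mult ennreal_leI flip: ennreal_mult)
    qed
    have "(\<integral>\<^sup>+x. ennreal (3 powr p) * ennreal (norm (f x) powr p) \<partial>M) = ennreal (3 powr p) * (\<integral>\<^sup>+x. ennreal (norm (f x) powr p) \<partial>M)"
      by (rule nn_integral_cmult) measurable
    then show "(\<integral>\<^sup>+x. ennreal (3 powr p) * ennreal (norm (f x) powr p) \<partial>M) < \<infinity>"
      using nz(1) by (simp add: Lp_functions_def ennreal_mult_less_top)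
    show "AE x in M. (\<lambda>i. ennreal (norm (f x - F i x) powr p)) \<longlonglongrightarrow> 0"
    proof (rule AE_I2)
      fix x assume x: "x \<in> space M"
      have "(\<lambda>i. norm (f x - F i x)) \<longlonglongrightarrow> norm (f x - f x)"
        by (intro tendsto_intros F x)
      then have "(\<lambda>i. norm (f x - F i x) powr p) \<longlonglongrightarrow> 0 powr p"
        using p by (intro tendsto_powr') auto
      then show "(\<lambda>i. ennreal (norm (f x - F i x) powr p)) \<longlonglongrightarrow> 0"
        using p by (auto simp flip: ennreal_0 intro: tendsto_ennrealI)
    qed
  qed auto
  then have lim: "(\<lambda>i. \<integral>\<^sup>+x. ennreal (norm (f x - F i x) powr p) \<partial>M) \<longlonglongrightarrow> 0" by simp
  have "\<Psi> f = 0"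
  proof (rule eq_0I[OF nz(1)])
    fix e :: real assume "e > 0"
    then have "\<forall>\<^sub>F i in sequentially. (\<integral>\<^sup>+x. ennreal (norm (f x - F i x) powr p) \<partial>M) < ennreal e"
      by (intro order_tendstoD(2)[OF lim]) simp
    then obtain i where "(\<integral>\<^sup>+x. ennreal (norm (f x - F i x) powr p) \<partial>M) < ennreal e"
      using eventually_happens'[OF sequentially_bot] by blast
    then show "\<exists>h\<in>Lp_functions M p. \<Psi> h = 0 \<and> (\<integral>\<^sup>+x. ennreal (norm (f x - h x) powr p) \<partial>M) \<le> ennreal e"
      using simple[OF F(1)] by (intro bexI[of _ "F i"]) auto
  qed
  then show False using nz(2) by simp
qed

end

section \<open>The character attached to a multiplicative functional\<close>

lemma dual_group_add: "\<gamma> \<in> dual_group \<Longrightarrow> \<gamma> (x + y) = \<gamma> x * \<gamma> y"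
  by (simp add: dual_group_def)

lemma dual_group_norm: "\<gamma> \<in> dual_group \<Longrightarrow> cmod (\<gamma> x) = 1"
  by (simp add: dual_group_def)

lemma dual_group_0:
  assumes "\<gamma> \<in> dual_group"
  shows "\<gamma> 0 = 1"
proof -
  have "\<gamma> 0 \<noteq> 0" using dual_group_norm[OF assms, of 0] by auto
  then show ?thesis using dual_group_add[OF assms, of 0 0] by simp
qed

lemma dual_group_cnj_mult: "\<gamma> \<in> dual_group \<Longrightarrow> cnj (\<gamma> x) * \<gamma> x = 1"
  using complex_norm_square[of "\<gamma> x"] by (simp add: dual_group_norm mult.commute)

lemma dual_group_uminus:
  assumes "\<gamma> \<in> dual_group"
  shows "\<gamma> (- x) = cnj (\<gamma> x)"
proof -
  have "\<gamma> (- x) * \<gamma> x = cnj (\<gamma> x) * \<gamma> x"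
    using dual_group_add[OF assms, of "- x" x] dual_group_0[OF assms] dual_group_cnj_mult[OF assms, of x] by simp
  moreover have "\<gamma> x \<noteq> 0" using dual_group_norm[OF assms, of x] by auto
  ultimately show ?thesis by simp
qed

context compact_haar
begin

lemma measure_UNIV [simp]: "measure M UNIV = 1"
  by (simp add: measure_def)

lemma dual_group_measurable: "\<gamma> \<in> dual_group \<Longrightarrow> \<gamma> \<in> borel_measurable M"
  by (intro continuous_imp_measurable) (simp add: dual_group_def)

lemma dual_group_cnj_measurable: "\<gamma> \<in> dual_group \<Longrightarrow> (\<lambda>x. cnj (\<gamma> x)) \<in> borel_measurable M"
  by (intro continuous_imp_measurable continuous_intros) (simp add: dual_group_def)

lemma integrable_bounded:
  fixes f :: "'g \<Rightarrow> 'b::{banach, second_countable_topology}"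
  assumes "f \<in> borel_measurable M" "\<And>x. norm (f x) \<le> k"
  shows "integrable M f"
  using assms by (intro integrable_const_bound[of _ k]) auto

lemma norm_integral_le:
  fixes f :: "'g \<Rightarrow> 'b::{banach, second_countable_topology}"
  assumes "f \<in> borel_measurable M" "\<And>x. norm (f x) \<le> k"
  shows "norm (\<integral>x. f x \<partial>M) \<le> k"
proof -
  have "norm (\<integral>x. f x \<partial>M) \<le> (\<integral>x. norm (f x) \<partial>M)" by (rule integral_norm_bound)
  also have "\<dots> \<le> (\<integral>x. k \<partial>M)"
    using integrable_bounded[OF assms] assms(2) by (intro integral_mono) auto
  also have "\<dots> = k" by simp
  finally show ?thesis .
qed

text \<open>The value \<open>\<gamma> (- y + x)\<close> splits as
  \<open>\<gamma> x * cnj (\<gamma> y)\<close>. So the functions \<open>\<gamma> a\<close> form an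
  ideal on which convolution with \<open>f\<close> multiplies \<open>a\<close> by the Fourier
  coefficient of \<open>f\<close>.\<close>

lemma convolution_character:
  fixes f :: "'g \<Rightarrow> 'a::{comm_complex_banach_algebra, second_countable_topology}"
  assumes \<gamma>: "\<gamma> \<in> dual_group" and f: "integrable M f"
  shows "convolution M f (\<lambda>x. scaleC (\<gamma> x) a) x = scaleC (\<gamma> x) ((\<integral>y. scaleC (cnj (\<gamma> y)) (f y) \<partial>M) * a)"
proof -
  note [measurable] = dual_group_measurable[OF \<gamma>] dual_group_cnj_measurable[OF \<gamma>] borel_measurable_integrable[OF f]
  have int: "integrable M (\<lambda>y. scaleC (cnj (\<gamma> y)) (f y))"
    by (rule Bochner_Integration.integrable_bound[OF f]) (auto simp: norm_scaleC dual_group_norm[OF \<gamma>])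
  have "f y * scaleC (\<gamma> (- y + x)) a = scaleC (\<gamma> x) (scaleC (cnj (\<gamma> y)) (f y) * a)" for y
  proof -
    have "\<gamma> (- y + x) = \<gamma> x * cnj (\<gamma> y)"
      by (simp only: dual_group_add[OF \<gamma>] dual_group_uminus[OF \<gamma>] mult.commute)
    then show ?thesis
      by (simp only: mult_scaleC_right mult_scaleC_left scaleC_scaleC)
  qed
  then have "convolution M f (\<lambda>x. scaleC (\<gamma> x) a) x = (\<integral>y. scaleC (\<gamma> x) (scaleC (cnj (\<gamma> y)) (f y) * a) \<partial>M)"
    by (simp only: convolution_def)
  also have "\<dots> = scaleC (\<gamma> x) ((\<integral>y. scaleC (cnj (\<gamma> y)) (f y) \<partial>M) * a)"
    unfolding integral_scaleC_right using int by simp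
  finally show ?thesis .
qed

lemma convolution_translate:
  fixes f g :: "'g \<Rightarrow> 'a::{comm_complex_banach_algebra, second_countable_topology}"
  assumes [measurable]: "f \<in> borel_measurable M" "g \<in> borel_measurable M"
  shows "convolution M (\<lambda>x. f (- y + x)) g x = convolution M f (\<lambda>x. g (- y + x)) x"
proof -
  have "(\<integral>z. f (- y + (y + z)) * g (- (y + z) + x) \<partial>M) = (\<integral>z. f (- y + z) * g (- z + x) \<partial>M)"
    by (rule integral_translate[of "\<lambda>z. f (- y + z) * g (- z + x)"]) measurable
  then show ?thesis by (simp add: convolution_def algebra_simps)
qed

text \<open>The weights depend on \<open>\<gamma>\<close> and the fibres of \<open>s\<close> but not
  on \<open>F\<close>. The same weights therefore represent an integral of translates of
  \<open>u\<close> and the integral of the values of \<open>\<Psi>\<close> on these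
  translates.\<close>

lemma integral_finite_valued:
  fixes \<gamma> F :: "'g \<Rightarrow> complex"
  assumes s: "finite (range s)" "\<And>z. s -` {z} \<in> sets M"
    and [measurable]: "\<gamma> \<in> borel_measurable M" and \<gamma>: "\<And>x. cmod (\<gamma> x) \<le> k"
  shows "(\<integral>y. \<gamma> y * F (s y) \<partial>M) = (\<Sum>z\<in>range s. (\<integral>y. \<gamma> y * indicator (s -` {z}) y \<partial>M) * F z)"
    and "(\<lambda>y. F (s y)) \<in> borel_measurable M"
proof -
  note [measurable] = s(2)
  have eq: "F (s y) = (\<Sum>z\<in>range s. indicator (s -` {z}) y * F z)" for y
  proof -
    have "(\<Sum>z\<in>range s. indicator (s -` {z}) y * F z) = (\<Sum>z\<in>range s. if z = s y then F z else 0)"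
      by (intro sum.cong) (auto simp: indicator_def)
    then show ?thesis using s(1) by (simp add: sum.delta)
  qed
  have int: "integrable M (\<lambda>y. \<gamma> y * indicator (s -` {z}) y)" for z
  proof (rule integrable_bounded)
    show "norm (\<gamma> y * indicator (s -` {z}) y) \<le> k" for y
      using \<gamma>[of y] order_trans[OF norm_ge_zero \<gamma>[of y]] by (auto simp: indicator_def)
  qed measurable
  have "(\<integral>y. \<gamma> y * F (s y) \<partial>M) = (\<integral>y. (\<Sum>z\<in>range s. (\<gamma> y * indicator (s -` {z}) y) * F z) \<partial>M)"
    by (subst eq) (simp add: sum_distrib_left mult.assoc)
  also have "\<dots> = (\<Sum>z\<in>range s. (\<integral>y. (\<gamma> y * indicator (s -` {z}) y) * F z \<partial>M))"
    using int by (intro Bochner_Integration.integral_sum integrable_mult_left)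
  also have "\<dots> = (\<Sum>z\<in>range s. (\<integral>y. \<gamma> y * indicator (s -` {z}) y \<partial>M) * F z)"
    by simp
  finally show "(\<integral>y. \<gamma> y * F (s y) \<partial>M) = (\<Sum>z\<in>range s. (\<integral>y. \<gamma> y * indicator (s -` {z}) y \<partial>M) * F z)" .
  show "(\<lambda>y. F (s y)) \<in> borel_measurable M"
    by (subst eq) measurable
qed

end

text \<open>All powers of \<open>h x\<close> are values of \<open>h\<close>, so boundedness forces
  \<open>cmod (h x) \<le> 1\<close>; the same bound at \<open>- x\<close> gives equality, as
  \<open>h x * h (- x) = 1\<close>.\<close>

lemma bounded_multiplicative_imp_norm_1:
  fixes h :: "'g::ab_group_add \<Rightarrow> complex"
  assumes mult: "\<And>x y. h (x + y) = h x * h y" and one: "h 0 = 1" and bound: "\<And>x. cmod (h x) \<le> k"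
  shows "cmod (h x) = 1"
proof -
  have le: "cmod (h x) \<le> 1" for x
  proof (rule ccontr)
    assume "\<not> cmod (h x) \<le> 1"
    then obtain n where n: "k < cmod (h x) ^ n"
      using real_arch_pow[of "cmod (h x)" k] by auto
    have "\<exists>z. h z = h x ^ n" for n
    proof (induction n)
      case 0
      then show ?case using one by auto
    next
      case (Suc n)
      then show ?case using mult[of x] by (metis power_Suc)
    qed
    then obtain z where "h z = h x ^ n" by blast
    then show False using bound[of z] n by (simp add: norm_power)
  qed
  have "cmod (h x) * cmod (h (- x)) = 1"
    using mult[of x "- x"] one by (simp flip: norm_mult)
  moreover have "cmod (h x) * cmod (h (- x)) \<le> cmod (h x) * 1"
    by (intro mult_left_mono le) auto
  ultimately show ?thesis using le[of x] by simp
qed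

context Lp_functional
begin

lemma norm_diff_le:
  assumes f: "f \<in> Lp_functions M p" "g \<in> Lp_functions M p" and k: "k \<ge> 0" and le: "\<And>x. norm (f x - g x) \<le> k"
  shows "cmod (\<Psi> f - \<Psi> g) \<le> k"
  unfolding diff[OF f, symmetric]
  using f by (intro norm_le_sup k le borel_measurable_diff Lp_functions_measurable)

context
  fixes u :: "'g \<Rightarrow> real" and a :: 'a
  assumes u: "continuous_on UNIV u" and nz: "\<Psi> (\<lambda>x. u x *\<^sub>R a) \<noteq> 0"
begin

definition shift :: "'g \<Rightarrow> 'g \<Rightarrow> 'a" where "shift y x = u (- y + x) *\<^sub>R a"

text \<open>The conjugate matches \<open>character_tensor\<close>, which integrates against
  \<open>cnj (\<gamma> x)\<close>: translation by \<open>y\<close> multiplies such a functional by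
  the conjugate of the character at \<open>y\<close>.\<close>

definition assoc_char :: "'g \<Rightarrow> complex" where "assoc_char y = cnj (\<Psi> (shift y) / \<Psi> (shift 0))"

lemma u_measurable [measurable]: "u \<in> borel_measurable M"
  by (rule continuous_imp_measurable[OF u])

lemma u_bounded: obtains k where "k \<ge> 0" "\<And>x. \<bar>u x\<bar> \<le> k"
proof -
  have "bounded (range u)"
    using compact_continuous_image[OF u compact_UNIV] by (rule compact_imp_bounded)
  then obtain k where "\<And>x. \<bar>u x\<bar> \<le> k" by (auto simp: bounded_iff)
  then show thesis using that by (metis abs_ge_zero order_trans)
qed

lemma shift_Lp: "shift y \<in> Lp_functions M p"
proof -
  obtain k where k: "k \<ge> 0" "\<And>x. \<bar>u x\<bar> \<le> k" by (rule u_bounded) (rule that)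
  have "(\<lambda>x. u x *\<^sub>R a) \<in> Lp_functions M p"
    using k p by (intro Lp_functions_bounded[of _ "k * norm a"]) (auto intro: mult_right_mono)
  from Lp_functions_translate[OF this, of "- y"] show ?thesis
    by (simp only: shift_def[abs_def])
qed

lemma shift_0: "\<Psi> (shift 0) \<noteq> 0"
  using nz by (simp add: shift_def[abs_def])

text \<open>Moving the translation by \<open>y\<close> from the first factor to the second gives the
  identity already for the convolutions. Division by the square of \<open>\<Psi> (shift 0)\<close>
  makes it the multiplicativity of \<open>assoc_char\<close>.\<close>

lemma mult_shift: "\<Psi> (shift y) * \<Psi> (shift z) = \<Psi> (shift 0) * \<Psi> (shift (y + z))"
proof -
  have "convolution M (\<lambda>x. shift 0 (- y + x)) (shift z) x = convolution M (shift 0) (\<lambda>x. shift z (- y + x)) x" for x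
    using Lp_functions_measurable[OF shift_Lp] by (intro convolution_translate)
  moreover have "(\<lambda>x. shift 0 (- y + x)) = shift y" "(\<lambda>x. shift z (- y + x)) = shift (y + z)"
    by (simp_all add: shift_def fun_eq_iff algebra_simps)
  ultimately have "convolution M (shift y) (shift z) = convolution M (shift 0) (shift (y + z))"
    by (simp add: fun_eq_iff)
  then show ?thesis by (metis convolution shift_Lp)
qed

lemma shift_close:
  assumes "\<And>x. dist (u (- y + x)) (u (- z + x)) < e"
  shows "cmod (\<Psi> (shift y) - \<Psi> (shift z)) \<le> e * norm a"
proof (rule norm_diff_le[OF shift_Lp shift_Lp])
  show "0 \<le> e * norm a" using assms[of 0] by (metis dist_not_less_zero linorder_not_le mult_nonneg_nonneg norm_ge_zero order_less_trans)
  fix x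
  have "norm (shift y x - shift z x) = dist (u (- y + x)) (u (- z + x)) * norm a"
    by (simp add: shift_def dist_real_def flip: scaleR_left_diff_distrib)
  then show "norm (shift y x - shift z x) \<le> e * norm a"
    using assms[of x] by (simp add: mult_right_mono)
qed

text \<open>The translates of \<open>u\<close> vary continuously in the sup norm, with respect to
  which \<open>\<Psi>\<close> is bounded.\<close>

lemma continuous_\<Psi>_shift: "continuous_on UNIV (\<lambda>y. \<Psi> (shift y))"
  unfolding continuous_on_def
proof
  fix z
  show "((\<lambda>y. \<Psi> (shift y)) \<longlongrightarrow> \<Psi> (shift z)) (at z within UNIV)"
  proof (rule tendstoI)
    fix e :: real assume e: "e > 0"
    define d where "d = e / (norm a + 1)"
    have d: "d > 0" "d * norm a < e"
      using e by (auto simp: d_def field_simps add_pos_nonneg)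
    obtain W where W: "open W" "0 \<in> W" "\<And>x y z. y - z \<in> W \<Longrightarrow> dist (u (- y + x)) (u (- z + x)) < d"
      by (rule uniformly_continuous_translate[OF compact_UNIV u d(1)]) (use that in auto)
    have "continuous_on UNIV (\<lambda>y. y - z)" by (intro continuous_intros)
    then have "open ((\<lambda>y. y - z) -` W)"
      using W(1) by (simp add: continuous_on_open_vimage)
    moreover have "z \<in> (\<lambda>y. y - z) -` W" using W(2) by simp
    ultimately have "\<forall>\<^sub>F y in at z. y \<in> (\<lambda>y. y - z) -` W"
      by (intro eventually_at_in_open') auto
    then show "\<forall>\<^sub>F y in at z. dist (\<Psi> (shift y)) (\<Psi> (shift z)) < e"
    proof eventually_elim
      case (elim y)
      then have "cmod (\<Psi> (shift y) - \<Psi> (shift z)) \<le> d * norm a"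
        by (intro shift_close W(3)) simp
      then show ?case using d(2) by (simp add: dist_norm)
    qed
  qed
qed

text \<open>Unimodularity follows from boundedness: all translates of \<open>u\<close> share one sup
  norm bound, so \<open>\<Psi>\<close> is bounded on them uniformly in \<open>y\<close>.\<close>

lemma assoc_char_dual: "assoc_char \<in> dual_group"
proof -
  obtain k where k: "k \<ge> 0" "\<And>x. \<bar>u x\<bar> \<le> k" by (rule u_bounded) (rule that)
  have mult: "assoc_char (x + y) = assoc_char x * assoc_char y" for x y
  proof -
    have "\<Psi> (shift (x + y)) / \<Psi> (shift 0) = (\<Psi> (shift x) / \<Psi> (shift 0)) * (\<Psi> (shift y) / \<Psi> (shift 0))"
      using mult_shift[of x y] shift_0 by (simp add: field_simps)
    then show ?thesis by (simp only: assoc_char_def complex_cnj_mult)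
  qed
  have one: "assoc_char 0 = 1" using shift_0 by (simp add: assoc_char_def)
  have "cmod (\<Psi> (shift y)) \<le> k * norm a" for y
    using k by (intro norm_le_sup Lp_functions_measurable[OF shift_Lp]) (auto simp: shift_def intro: mult_right_mono)
  then have bound: "cmod (assoc_char y) \<le> k * norm a / cmod (\<Psi> (shift 0))" for y
    by (simp add: assoc_char_def norm_divide divide_right_mono)
  have "continuous_on UNIV assoc_char"
    unfolding assoc_char_def[abs_def] using shift_0 by (intro continuous_intros continuous_\<Psi>_shift) auto
  then show ?thesis
    using bounded_multiplicative_imp_norm_1[of assoc_char, OF mult one bound] by (simp add: dual_group_def mult)
qed

lemma assoc_char_mult_shift: "assoc_char y * \<Psi> (shift y) = \<Psi> (shift 0)"
proof -
  have "\<Psi> (shift y) = cnj (assoc_char y) * \<Psi> (shift 0)" using shift_0 by (simp add: assoc_char_def)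
  then show ?thesis using dual_group_cnj_mult[OF assoc_char_dual, of y] by (simp add: mult_ac)
qed

text \<open>The convolution \<open>v\<close> is evaluated in two ways. Invariance gives
  \<open>v x = assoc_char x * v 0\<close>, while formally \<open>\<Psi>\<close> sends
  \<open>v a\<close> to the integral of \<open>assoc_char y * \<Psi> (shift y)\<close>, whose
  integrand is constantly \<open>\<Psi> (shift 0)\<close>. Hence \<open>v 0\<close> times the value
  in question is nonzero. The finite sum \<open>S\<close> makes the formal exchange
  rigorous.\<close>

lemma \<Psi>_assoc_char_nonzero: "\<Psi> (\<lambda>x. scaleC (assoc_char x) a) \<noteq> 0"
proof -
  note [measurable] = dual_group_measurable[OF assoc_char_dual]
  obtain k where k: "k \<ge> 0" "\<And>x. \<bar>u x\<bar> \<le> k" by (rule u_bounded) (rule that)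
  define v where "v x = (\<integral>y. assoc_char y * of_real (u (- y + x)) \<partial>M)" for x
  have v: "v x = assoc_char x * v 0" for x
  proof -
    have "v x = (\<integral>y. assoc_char (x + y) * of_real (u (- (x + y) + x)) \<partial>M)"
      unfolding v_def by (rule integral_translate[symmetric]) measurable
    also have "\<dots> = (\<integral>y. assoc_char x * (assoc_char y * of_real (u (- y + 0))) \<partial>M)"
      by (simp add: dual_group_add[OF assoc_char_dual] mult.assoc)
    also have "\<dots> = assoc_char x * v 0"
      unfolding v_def by (rule integral_mult_right_zero)
    finally show ?thesis .
  qed
  have charL: "(\<lambda>x. scaleC (assoc_char x) a) \<in> Lp_functions M p"
    using p by (intro Lp_functions_bounded[of _ "norm a"]) (auto simp: norm_scaleC dual_group_norm[OF assoc_char_dual])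
  have va: "(\<lambda>x. scaleC (v x) a) = (\<lambda>x. scaleC (v 0) (scaleC (assoc_char x) a))"
    by (subst v) (simp add: scaleC_scaleC mult.commute)
  have vL: "(\<lambda>x. scaleC (v x) a) \<in> Lp_functions M p"
    unfolding va by (rule Lp_functions_scaleC[OF charL])
  have "cmod (\<Psi> (\<lambda>x. scaleC (v x) a) - \<Psi> (shift 0)) \<le> 0 + e" if e: "e > 0" for e
  proof -
    \<comment> \<open>Each of the two approximations, \<open>1\<close> and \<open>2\<close>, costs
      at most \<open>d * norm a\<close>.\<close>
    define d where "d = e / (2 * norm a + 1)"
    have d: "d > 0" "2 * (d * norm a) \<le> e"
      using e by (auto simp: d_def field_simps add_pos_nonneg add_nonneg_pos)
    obtain s :: "'g \<Rightarrow> 'g" where s: "finite (range s)" "\<And>z. s -` {z} \<in> sets baire"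
        "\<And>x y. dist (u (- y + x)) (u (- s y + x)) < d"
      by (rule finite_valued_translate_approx[OF compact_UNIV u d(1)]) (use that in auto)
    have sM: "s -` {z} \<in> sets M" for z using s(2)[of z] sets_baire_subset_borel by auto
    note fv = integral_finite_valued[OF s(1) sM dual_group_measurable[OF assoc_char_dual] order_refl[THEN order_trans, OF eq_refl[OF dual_group_norm[OF assoc_char_dual]]]]
    define c where "c z = (\<integral>y. assoc_char y * indicator (s -` {z}) y \<partial>M)" for z
    define S where "S x = (\<integral>y. assoc_char y * of_real (u (- s y + x)) \<partial>M)" for x
    have S: "S x = (\<Sum>z\<in>range s. c z * of_real (u (- z + x)))" for x
      unfolding S_def c_def by (rule fv(1)[of "\<lambda>z. of_real (u (- z + x))"])
    have Sa: "scaleC (S x) a = (\<Sum>z\<in>range s. scaleC (c z) (shift z x))" for x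
      unfolding S by (subst linear_sum[OF bounded_linear.linear[OF bounded_linear_scaleC_left]])
        (simp add: shift_def scaleR_eq_scaleC scaleC_scaleC)
    have SL: "(\<lambda>x. scaleC (S x) a) \<in> Lp_functions M p"
      and \<Psi>S_sum: "\<Psi> (\<lambda>x. scaleC (S x) a) = (\<Sum>z\<in>range s. c z * \<Psi> (shift z))"
    proof -
      have "\<Psi> (\<lambda>x. scaleC (S x) a) = (\<Sum>z\<in>range s. \<Psi> (\<lambda>x. scaleC (c z) (shift z x)))"
        unfolding Sa by (rule sum[OF s(1)]) (intro Lp_functions_scaleC shift_Lp)
      then show "\<Psi> (\<lambda>x. scaleC (S x) a) = (\<Sum>z\<in>range s. c z * \<Psi> (shift z))"
        by (simp add: scaleC[OF shift_Lp])
      \<comment> \<open>Measurability of \<open>S\<close> is read off the finite sum, its bound off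
        the integral.\<close>
      have [measurable]: "S \<in> borel_measurable M"
        unfolding S[abs_def] by measurable
      have "cmod (S x) \<le> k" for x
        unfolding S_def
      proof (rule norm_integral_le)
        show "(\<lambda>y. assoc_char y * of_real (u (- s y + x))) \<in> borel_measurable M"
          using fv(2)[of "\<lambda>z. of_real (u (- z + x))"] by measurable
        show "norm (assoc_char y * of_real (u (- s y + x))) \<le> k" for y
          using k by (simp add: norm_mult dual_group_norm[OF assoc_char_dual])
      qed
      then show "(\<lambda>x. scaleC (S x) a) \<in> Lp_functions M p"
        using p by (intro Lp_functions_bounded[of _ "k * norm a"]) (auto simp: norm_scaleC intro: mult_right_mono)
    qed
    \<comment> \<open>The weights \<open>c z\<close> also represent this integral, so
      \<open>\<Psi>\<close> has passed under the integral sign.\<close>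
    have \<Psi>S: "\<Psi> (\<lambda>x. scaleC (S x) a) = (\<integral>y. assoc_char y * \<Psi> (shift (s y)) \<partial>M)"
      unfolding \<Psi>S_sum c_def by (rule fv(1)[symmetric])
    have close: "cmod (\<Psi> (shift (s y)) - \<Psi> (shift y)) \<le> d * norm a" for y
      using s(3)[of y] by (intro shift_close) (simp add: dist_commute)
    have "(\<lambda>y. \<Psi> (shift (s y))) \<in> borel_measurable M" by (rule fv(2))
    have "(\<lambda>y. \<Psi> (shift y)) \<in> borel_measurable M"
      by (rule continuous_imp_measurable[OF continuous_\<Psi>_shift])
    have d_bound: "norm (assoc_char y * (\<Psi> (shift (s y)) - \<Psi> (shift y))) \<le> d * norm a" for y
      using close[of y] by (simp add: norm_mult dual_group_norm[OF assoc_char_dual])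
    have d_meas: "(\<lambda>y. assoc_char y * (\<Psi> (shift (s y)) - \<Psi> (shift y))) \<in> borel_measurable M"
      by (intro borel_measurable_times borel_measurable_diff dual_group_measurable[OF assoc_char_dual]) fact+
    \<comment> \<open>Subtracting the constant \<open>assoc_char y * \<Psi> (shift y)\<close> inside
      the integral removes exactly \<open>\<Psi> (shift 0)\<close>, as the total mass is 1.\<close>
    have eq: "(\<integral>y. assoc_char y * \<Psi> (shift (s y)) \<partial>M) - \<Psi> (shift 0) = (\<integral>y. assoc_char y * (\<Psi> (shift (s y)) - \<Psi> (shift y)) \<partial>M)"
    proof -
      have "(\<integral>y. assoc_char y * \<Psi> (shift (s y)) \<partial>M) = (\<integral>y. assoc_char y * (\<Psi> (shift (s y)) - \<Psi> (shift y)) + \<Psi> (shift 0) \<partial>M)"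
        by (simp add: right_diff_distrib assoc_char_mult_shift)
      also have "\<dots> = (\<integral>y. assoc_char y * (\<Psi> (shift (s y)) - \<Psi> (shift y)) \<partial>M) + (\<integral>y. \<Psi> (shift 0) \<partial>M)"
        by (rule Bochner_Integration.integral_add[OF integrable_bounded[OF d_meas d_bound] integrable_const])
      finally show ?thesis by simp
    qed
    have 1: "cmod (\<Psi> (\<lambda>x. scaleC (S x) a) - \<Psi> (shift 0)) \<le> d * norm a"
      unfolding \<Psi>S eq by (rule norm_integral_le[OF d_meas d_bound])
    have 2: "cmod (\<Psi> (\<lambda>x. scaleC (v x) a) - \<Psi> (\<lambda>x. scaleC (S x) a)) \<le> d * norm a"
    proof (rule norm_diff_le[OF vL SL])
      fix x
      have [measurable]: "(\<lambda>y. complex_of_real (u (- s y + x))) \<in> borel_measurable M"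
        by (rule fv(2))
      have int: "integrable M (\<lambda>y. assoc_char y * of_real (u (- y + x)))" "integrable M (\<lambda>y. assoc_char y * of_real (u (- s y + x)))"
        using k by (intro integrable_bounded[of _ k], measurable, simp add: norm_mult dual_group_norm[OF assoc_char_dual])+
      have "v x - S x = (\<integral>y. assoc_char y * of_real (u (- y + x)) - assoc_char y * of_real (u (- s y + x)) \<partial>M)"
        unfolding v_def S_def by (rule Bochner_Integration.integral_diff[OF int, symmetric])
      also have "cmod \<dots> \<le> d"
      proof (rule norm_integral_le)
        fix y
        have "norm (assoc_char y * of_real (u (- y + x)) - assoc_char y * of_real (u (- s y + x))) = dist (u (- y + x)) (u (- s y + x))"
          by (simp add: norm_mult dual_group_norm[OF assoc_char_dual] dist_real_def flip: right_diff_distrib of_real_diff)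
        then show "norm (assoc_char y * of_real (u (- y + x)) - assoc_char y * of_real (u (- s y + x))) \<le> d"
          using s(3)[of y x] by simp
      qed measurable
      finally have vS: "cmod (v x - S x) \<le> d" .
      have "scaleC (v x) a - scaleC (S x) a = scaleC (v x - S x) a"
        by (rule linear_diff[OF bounded_linear.linear[OF bounded_linear_scaleC_left], symmetric])
      then show "norm (scaleC (v x) a - scaleC (S x) a) \<le> d * norm a"
        using vS by (simp add: norm_scaleC mult_right_mono)
    qed (use d in auto)
    show ?thesis
      using norm_triangle_mono[OF 2 1] d(2) by simp
  qed
  then have "cmod (\<Psi> (\<lambda>x. scaleC (v x) a) - \<Psi> (shift 0)) \<le> 0" by (rule field_le_epsilon)
  then have "v 0 * \<Psi> (\<lambda>x. scaleC (assoc_char x) a) = \<Psi> (shift 0)"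
    unfolding va scaleC[OF charL] by simp
  then show ?thesis using shift_0 by auto
qed

end

proposition ex_character_tensor:
  assumes "f \<in> Lp_functions M p" "\<Psi> f \<noteq> 0"
  obtains \<gamma> \<phi> where "\<gamma> \<in> dual_group" "\<phi> \<in> gelfand_spectrum type_algebra"
    "\<And>f. f \<in> Lp_functions M p \<Longrightarrow> \<Psi> f = (\<integral>x. cnj (\<gamma> x) * \<phi> (f x) \<partial>M)"
proof -
  obtain u a where u: "continuous_on UNIV (u :: 'g \<Rightarrow> real)" "\<Psi> (\<lambda>x. u x *\<^sub>R a) \<noteq> 0"
    by (rule ex_continuous_nonzero[OF assms])
  obtain \<gamma> where \<gamma>: "\<gamma> \<in> dual_group" and nz: "\<Psi> (\<lambda>x. scaleC (\<gamma> x) a) \<noteq> 0"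
    using assoc_char_dual[OF u] \<Psi>_assoc_char_nonzero[OF u] by blast
  note [measurable] = dual_group_measurable[OF \<gamma>] dual_group_cnj_measurable[OF \<gamma>]
  define \<phi> where "\<phi> b = \<Psi> (\<lambda>x. scaleC (\<gamma> x) b)" for b
  have L: "(\<lambda>x. scaleC (\<gamma> x) b) \<in> Lp_functions M p" for b
    using p by (intro Lp_functions_bounded[of _ "norm b"]) (auto simp: norm_scaleC dual_group_norm[OF \<gamma>])
  have mult: "\<Psi> f * \<phi> b = \<phi> ((\<integral>x. scaleC (cnj (\<gamma> x)) (f x) \<partial>M) * b)" if f: "f \<in> Lp_functions M p" for f b
  proof -
    have "\<Psi> f * \<phi> b = \<Psi> (convolution M f (\<lambda>x. scaleC (\<gamma> x) b))"
      unfolding \<phi>_def by (rule convolution[OF f L, symmetric])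
    moreover have "convolution M f (\<lambda>x. scaleC (\<gamma> x) b) = (\<lambda>x. scaleC (\<gamma> x) ((\<integral>y. scaleC (cnj (\<gamma> y)) (f y) \<partial>M) * b))"
      using p by (intro ext convolution_character \<gamma> Lp_functions_imp_integrable[OF f]) auto
    ultimately show ?thesis by (simp add: \<phi>_def)
  qed
  have \<phi>: "\<phi> \<in> gelfand_spectrum type_algebra"
    unfolding gelfand_spectrum_type_algebra_iff
  proof (intro conjI allI)
    show "\<phi> (x + y) = \<phi> x + \<phi> y" for x y
      unfolding \<phi>_def scaleC_add_right by (rule add[OF L L])
    show "\<phi> (scaleC c x) = c * \<phi> x" for c x
      unfolding \<phi>_def scaleC[OF L, symmetric] by (simp add: scaleC_scaleC mult.commute)
    \<comment> \<open>The Fourier coefficient of \<open>\<gamma> x\<close> at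
      \<open>\<gamma>\<close> is \<open>x\<close> itself, because \<open>\<gamma>\<close> is
      unimodular and the mass is 1.\<close>
    show "\<phi> (x * y) = \<phi> x * \<phi> y" for x y
      using mult[OF L, of x y] by (simp add: \<phi>_def scaleC_scaleC dual_group_cnj_mult[OF \<gamma>])
    show "\<exists>x. \<phi> x \<noteq> 0" using nz by (auto simp: \<phi>_def)
  qed
  have "\<Psi> f = (\<integral>x. cnj (\<gamma> x) * \<phi> (f x) \<partial>M)" if f: "f \<in> Lp_functions M p" for f
  proof -
    have intf: "integrable M f"
      using p by (intro Lp_functions_imp_integrable[OF f]) auto
    then have int: "integrable M (\<lambda>y. scaleC (cnj (\<gamma> y)) (f y))"
      by (rule Bochner_Integration.integrable_bound)
        (use borel_measurable_integrable[OF intf] in \<open>auto simp: norm_scaleC dual_group_norm[OF \<gamma>]\<close>)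
    have "\<Psi> f * \<phi> a = \<phi> (\<integral>x. scaleC (cnj (\<gamma> x)) (f x) \<partial>M) * \<phi> a"
      using mult[OF f, of a] \<phi> by (simp add: gelfand_spectrum_type_algebra_iff)
    \<comment> \<open>The factor \<open>\<phi> a\<close> cancels: it is the nonzero value of
      \<open>\<Psi>\<close> on \<open>\<gamma> a\<close>.\<close>
    then have "\<Psi> f = \<phi> (\<integral>x. scaleC (cnj (\<gamma> x)) (f x) \<partial>M)"
      using nz by (simp add: \<phi>_def)
    \<comment> \<open>Characters of a Banach algebra are bounded, so \<open>\<phi>\<close> passes
      under the Bochner integral.\<close>
    also have "\<dots> = (\<integral>x. \<phi> (scaleC (cnj (\<gamma> x)) (f x)) \<partial>M)"
      by (rule integral_bounded_linear[OF gelfand_spectrum_type_algebra_bounded_linear[OF \<phi>] int, symmetric])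
    also have "\<dots> = (\<integral>x. cnj (\<gamma> x) * \<phi> (f x) \<partial>M)"
      using \<phi> by (simp add: gelfand_spectrum_type_algebra_iff)
    finally show ?thesis .
  qed
  with \<gamma> \<phi> show thesis by (rule that)
qed

end

section \<open>The spectrum\<close>

lemma ae_class_eqI: "AE x in M. f x = g x \<Longrightarrow> ae_class M f = ae_class M g"
  unfolding ae_class_def by (auto elim: eventually_elim2)

lemma rep_ae_class:
  assumes "f \<in> borel_measurable M"
  shows "rep (ae_class M f) \<in> borel_measurable M" "AE x in M. rep (ae_class M f) x = f x"
proof -
  have "f \<in> ae_class M f" using assms by (simp add: ae_class_def)
  then have "rep (ae_class M f) \<in> ae_class M f" unfolding rep_def by (rule someI[where P = "\<lambda>h. h \<in> ae_class M f"])
  then show "rep (ae_class M f) \<in> borel_measurable M" "AE x in M. rep (ae_class M f) x = f x"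
    by (auto simp: ae_class_def)
qed

context compact_haar
begin

section \<open>Operations and functionals on classes\<close>

lemma Lp_carrier: "alg_carrier (Lp_algebra M p) = ae_class M ` Lp_functions M p"
  by (simp add: Lp_algebra_def)

lemma Lp_add:
  fixes f g :: "'g \<Rightarrow> 'a::{comm_complex_banach_algebra, second_countable_topology}"
  assumes "f \<in> borel_measurable M" "g \<in> borel_measurable M"
  shows "alg_add (Lp_algebra M p) (ae_class M f) (ae_class M g) = ae_class M (\<lambda>x. f x + g x)"
proof -
  have "AE x in M. rep (ae_class M f) x + rep (ae_class M g) x = f x + g x"
    using rep_ae_class(2)[OF assms(1)] rep_ae_class(2)[OF assms(2)] by eventually_elim simp
  then show ?thesis by (simp add: Lp_algebra_def ae_class_eqI)
qed

lemma Lp_scale: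
  fixes f :: "'g \<Rightarrow> 'a::{comm_complex_banach_algebra, second_countable_topology}"
  assumes "f \<in> borel_measurable M"
  shows "alg_scale (Lp_algebra M p) c (ae_class M f) = ae_class M (\<lambda>x. scaleC c (f x))"
proof -
  have "AE x in M. scaleC c (rep (ae_class M f) x) = scaleC c (f x)"
    using rep_ae_class(2)[OF assms] by eventually_elim simp
  then show ?thesis by (simp add: Lp_algebra_def ae_class_eqI)
qed

lemma Lp_mult:
  fixes f g :: "'g \<Rightarrow> 'a::{comm_complex_banach_algebra, second_countable_topology}"
  assumes "f \<in> borel_measurable M" "g \<in> borel_measurable M"
  shows "alg_mult (Lp_algebra M p) (ae_class M f) (ae_class M g) = ae_class M (convolution M f g)"
proof -
  have "convolution M (rep (ae_class M f)) (rep (ae_class M g)) x = convolution M f g x" for x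
    by (intro convolution_cong_AE rep_ae_class assms)
  then show ?thesis by (simp add: Lp_algebra_def ae_class_eqI)
qed

text \<open>Replaces the operations on classes by those on functions, the form in which
  \<open>Lp_functional\<close> is stated.\<close>

lemma gelfand_spectrum_Lp_iff:
  fixes \<Phi> :: "('g \<Rightarrow> 'a::{comm_complex_banach_algebra, second_countable_topology}) set \<Rightarrow> complex"
  shows "\<Phi> \<in> gelfand_spectrum (Lp_algebra M p) \<longleftrightarrow>
    \<Phi> \<in> extensional (alg_carrier (Lp_algebra M p)) \<and>
    (\<forall>f\<in>Lp_functions M p. \<forall>g\<in>Lp_functions M p.
      \<Phi> (ae_class M (\<lambda>x. f x + g x)) = \<Phi> (ae_class M f) + \<Phi> (ae_class M g)) \<and>
    (\<forall>c. \<forall>f\<in>Lp_functions M p. \<Phi> (ae_class M (\<lambda>x. scaleC c (f x))) = c * \<Phi> (ae_class M f)) \<and>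
    (\<forall>f\<in>Lp_functions M p. \<forall>g\<in>Lp_functions M p.
      \<Phi> (ae_class M (convolution M f g)) = \<Phi> (ae_class M f) * \<Phi> (ae_class M g)) \<and>
    (\<exists>f\<in>Lp_functions M p. \<Phi> (ae_class M f) \<noteq> 0)"
  unfolding gelfand_spectrum_def Lp_carrier
  by (simp add: Lp_add Lp_scale Lp_mult Lp_functions_measurable)

text \<open>Multiplicativity of \<open>\<gamma>\<close> and \<open>\<phi>\<close> turns the
  integrand into \<open>F y * K (- y + x)\<close>, and Fubini with translation invariance separates
  the factors. The product of the norms of \<open>f0\<close> and the translated \<open>g0\<close> is
  an integrable majorant on the square.\<close>

lemma integral_character_convolution:
  fixes f g :: "'g \<Rightarrow> 'a::{comm_complex_banach_algebra, second_countable_topology}"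
  assumes \<gamma>: "\<gamma> \<in> dual_group" and \<phi>: "\<phi> \<in> gelfand_spectrum type_algebra"
    and f: "integrable M f" and g: "integrable M g"
  shows "(\<integral>x. cnj (\<gamma> x) * \<phi> (convolution M f g x) \<partial>M) =
    (\<integral>x. cnj (\<gamma> x) * \<phi> (f x) \<partial>M) * (\<integral>x. cnj (\<gamma> x) * \<phi> (g x) \<partial>M)"
proof -
  have fM: "f \<in> borel_measurable M" and gM: "g \<in> borel_measurable M"
    using f g by auto
  obtain f0 where f0[measurable]: "f0 \<in> borel_measurable baire" and ff0: "AE x in M. f x = f0 x"
    using AE_eq_baire_measurable[OF fM] by metis
  obtain g0 where g0[measurable]: "g0 \<in> borel_measurable baire" and gg0: "AE x in M. g x = g0 x"
    using AE_eq_baire_measurable[OF gM] by metis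
  have bl: "bounded_linear \<phi>"
    by (rule gelfand_spectrum_type_algebra_bounded_linear[OF \<phi>])
  have \<phi>_borel[measurable]: "\<phi> \<in> borel_measurable borel"
    by (intro borel_measurable_continuous_onI linear_continuous_on bl)
  have cont: "continuous_on UNIV (\<lambda>x. cnj (\<gamma> x))"
    using \<gamma> by (auto simp: dual_group_def intro: continuous_intros)
  have \<gamma>_baire[measurable]: "(\<lambda>x. cnj (\<gamma> x)) \<in> borel_measurable baire"
    by (rule continuous_complex_imp_measurable_baire[OF cont])
  have finf: "(\<integral>\<^sup>+x. ennreal (norm (f0 x)) \<partial>baire_part) < \<infinity>"
    using f nn_integral_norm_eq_baire[OF fM f0 _ ff0, of "\<lambda>a. ennreal (norm a)"]
    by (simp add: integrable_iff_bounded)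
  have fing: "(\<integral>\<^sup>+x. ennreal (norm (g0 x)) \<partial>baire_part) < \<infinity>"
    using g nn_integral_norm_eq_baire[OF gM g0 _ gg0, of "\<lambda>a. ennreal (norm a)"]
    by (simp add: integrable_iff_bounded)
  define F where "F x = cnj (\<gamma> x) * \<phi> (f0 x)" for x
  define K where "K x = cnj (\<gamma> x) * \<phi> (g0 x)" for x
  have [measurable]: "F \<in> borel_measurable baire" "K \<in> borel_measurable baire"
    unfolding F_def K_def by measurable
  have norm_le: "cmod (F x) \<le> norm (f0 x)" "cmod (K x) \<le> norm (g0 x)" for x
    by (simp_all add: F_def K_def norm_mult dual_group_norm[OF \<gamma>] gelfand_spectrum_type_algebra_norm_le[OF \<phi>])
  have split: "cnj (\<gamma> x) = cnj (\<gamma> y) * cnj (\<gamma> (- y + x))" for x y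
    using dual_group_add[OF \<gamma>, of y "- y + x"] by (simp flip: complex_cnj_mult)
  have m: "(\<lambda>(x, y). norm (f0 y) * norm (g0 (- y + x))) \<in> borel_measurable (baire_part \<Otimes>\<^sub>M baire_part)"
    and m': "(\<lambda>(x, y). F y * K (- y + x)) \<in> borel_measurable (baire_part \<Otimes>\<^sub>M baire_part)"
    by measurable
  have fin: "(\<integral>\<^sup>+x. (\<integral>\<^sup>+y. ennreal (norm (f0 y)) * ennreal (norm (g0 (- y + x))) \<partial>baire_part) \<partial>baire_part) < \<infinity>"
  proof -
    have "(\<integral>\<^sup>+x. (\<integral>\<^sup>+y. ennreal (norm (f0 y)) * ennreal (norm (g0 (- y + x))) \<partial>baire_part) \<partial>baire_part) =
        (\<integral>\<^sup>+x. ennreal (norm (f0 x)) \<partial>baire_part) * (\<integral>\<^sup>+x. ennreal (norm (g0 x)) \<partial>baire_part)"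
      by (rule nn_integral_convolution_kernel) measurable
    then show ?thesis using finf fing by (simp add: ennreal_mult_less_top)
  qed
  have int: "integrable (baire_part \<Otimes>\<^sub>M baire_part) (\<lambda>(x, y). norm (f0 y) * norm (g0 (- y + x)))"
  proof (rule integrableI_bounded[OF m])
    have "(\<integral>\<^sup>+q. ennreal (norm (case q of (x, y) \<Rightarrow> norm (f0 y) * norm (g0 (- y + x)))) \<partial>(baire_part \<Otimes>\<^sub>M baire_part)) =
        (\<integral>\<^sup>+x. (\<integral>\<^sup>+y. ennreal (norm (f0 y)) * ennreal (norm (g0 (- y + x))) \<partial>baire_part) \<partial>baire_part)"
      using m by (subst baire_part.nn_integral_fst[symmetric]) (auto simp: ennreal_mult)
    with fin show "(\<integral>\<^sup>+q. ennreal (norm (case q of (x, y) \<Rightarrow> norm (f0 y) * norm (g0 (- y + x)))) \<partial>(baire_part \<Otimes>\<^sub>M baire_part)) < \<infinity>"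
      by (simp only:)
  qed
  have int': "integrable (baire_part \<Otimes>\<^sub>M baire_part) (\<lambda>(x, y). F y * K (- y + x))"
    by (rule Bochner_Integration.integrable_bound[OF int m'])
      (auto simp: norm_mult intro!: mult_mono norm_le AE_I2)
  \<comment> \<open>For almost every \<open>x\<close> the algebra-valued integrand is integrable,
    which is what lets \<open>\<phi>\<close> pass under the convolution integral.\<close>
  have AE: "AE x in baire_part. integrable baire_part (\<lambda>y. norm (f0 y) * norm (g0 (- y + x)))"
    using baire_part_pair.AE_integrable_fst'[OF int] by simp
  have conv: "AE x in baire_part. cnj (\<gamma> x) * \<phi> (convolution M f g x) = (\<integral>y. F y * K (- y + x) \<partial>baire_part)"
    using AE
  proof eventually_elim
    case (elim x)
    have "(\<lambda>y. f0 y * g0 (- y + x)) \<in> borel_measurable baire_part"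
      using borel_measurable_times[OF f0 measurable_compose[OF minus_plus_measurable_baire g0]] by simp
    then have intx: "integrable baire_part (\<lambda>y. f0 y * g0 (- y + x))"
      by (rule Bochner_Integration.integrable_bound[OF elim]) (simp add: norm_mult_ineq)
    have "\<phi> (convolution M f g x) = (\<integral>y. \<phi> (f0 y * g0 (- y + x)) \<partial>baire_part)"
      unfolding convolution_baire[OF fM gM f0 g0 ff0 gg0]
      by (rule integral_bounded_linear[OF bl intx, symmetric])
    then have "cnj (\<gamma> x) * \<phi> (convolution M f g x) = (\<integral>y. cnj (\<gamma> x) * \<phi> (f0 y * g0 (- y + x)) \<partial>baire_part)"
      by (simp only: integral_mult_right_zero)
    also have "\<dots> = (\<integral>y. F y * K (- y + x) \<partial>baire_part)"
    proof (rule Bochner_Integration.integral_cong[OF refl])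
      fix y
      show "cnj (\<gamma> x) * \<phi> (f0 y * g0 (- y + x)) = F y * K (- y + x)"
        unfolding split[of x y] F_def K_def using \<phi> by (simp add: gelfand_spectrum_type_algebra_iff mult_ac)
    qed
    finally show ?case .
  qed
  have \<phi>conv: "(\<lambda>x. \<phi> (convolution M f g x)) \<in> borel_measurable baire"
    by (rule measurable_compose[OF borel_measurable_baire_convolution[OF fM gM] \<phi>_borel])
  have "(\<integral>x. cnj (\<gamma> x) * \<phi> (convolution M f g x) \<partial>M) = (\<integral>x. cnj (\<gamma> x) * \<phi> (convolution M f g x) \<partial>baire_part)"
    by (intro integral_baire_part[symmetric] borel_measurable_times \<gamma>_baire \<phi>conv)
  also have "\<dots> = (\<integral>x. (\<integral>y. F y * K (- y + x) \<partial>baire_part) \<partial>baire_part)"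
  proof (rule integral_cong_AE[OF _ _ conv])
    show "(\<lambda>x. cnj (\<gamma> x) * \<phi> (convolution M f g x)) \<in> borel_measurable baire_part"
      using borel_measurable_times[OF \<gamma>_baire \<phi>conv] by simp
    show "(\<lambda>x. \<integral>y. F y * K (- y + x) \<partial>baire_part) \<in> borel_measurable baire_part"
      using baire_part_pair.integrable_fst'[OF int'] by simp
  qed
  also have "\<dots> = (\<integral>y. (\<integral>x. F y * K (- y + x) \<partial>baire_part) \<partial>baire_part)"
    by (rule baire_part_pair.Fubini_integral[OF int', symmetric])
  also have "\<dots> = (\<integral>y. F y * (\<integral>x. K x \<partial>M) \<partial>baire_part)"
  proof (rule Bochner_Integration.integral_cong[OF refl])
    fix y
    have "(\<integral>x. K (- y + x) \<partial>baire_part) = (\<integral>x. K (- y + x) \<partial>M)"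
      by (rule integral_baire_part) measurable
    also have "\<dots> = (\<integral>x. K x \<partial>M)"
      by (rule integral_translate) (rule baire_measurable_imp_measurable, measurable)
    finally show "(\<integral>x. F y * K (- y + x) \<partial>baire_part) = F y * (\<integral>x. K x \<partial>M)"
      by (simp only: integral_mult_right_zero)
  qed
  also have "\<dots> = (\<integral>x. F x \<partial>M) * (\<integral>x. K x \<partial>M)"
    by (simp add: integral_baire_part)
  also have "(\<integral>x. F x \<partial>M) = (\<integral>x. cnj (\<gamma> x) * \<phi> (f x) \<partial>M)"
  proof (rule integral_cong_AE)
    show "AE x in M. F x = cnj (\<gamma> x) * \<phi> (f x)"
      using ff0 by eventually_elim (simp add: F_def)
    show "F \<in> borel_measurable M" by (rule baire_measurable_imp_measurable) measurable
    show "(\<lambda>x. cnj (\<gamma> x) * \<phi> (f x)) \<in> borel_measurable M"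
      by (intro borel_measurable_times dual_group_cnj_measurable[OF \<gamma>] measurable_compose[OF fM \<phi>_borel])
  qed
  also have "(\<integral>x. K x \<partial>M) = (\<integral>x. cnj (\<gamma> x) * \<phi> (g x) \<partial>M)"
  proof (rule integral_cong_AE)
    show "AE x in M. K x = cnj (\<gamma> x) * \<phi> (g x)"
      using gg0 by eventually_elim (simp add: K_def)
    show "K \<in> borel_measurable M" by (rule baire_measurable_imp_measurable) measurable
    show "(\<lambda>x. cnj (\<gamma> x) * \<phi> (g x)) \<in> borel_measurable M"
      by (intro borel_measurable_times dual_group_cnj_measurable[OF \<gamma>] measurable_compose[OF gM \<phi>_borel])
  qed
  finally show ?thesis .
qed

text \<open>Evaluates both nested restrictions, to L^1 inside \<open>character_tensor\<close> and to
  L^p outside, and removes the chosen representative.\<close>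

lemma character_tensor_ae_class:
  fixes f :: "'g \<Rightarrow> 'a::{comm_complex_banach_algebra, second_countable_topology}"
  assumes \<gamma>: "\<gamma> \<in> dual_group" and \<phi>: "\<phi> \<in> gelfand_spectrum type_algebra"
    and f: "f \<in> Lp_functions M p" and p: "p > 1"
  shows "restrict (character_tensor M \<gamma> \<phi>) (alg_carrier (Lp_algebra M p)) (ae_class M f) =
    (\<integral>x. cnj (\<gamma> x) * \<phi> (f x) \<partial>M)"
proof -
  have X: "ae_class M f \<in> alg_carrier (Lp_algebra M p)"
    using f by (simp add: Lp_carrier)
  then have X1: "ae_class M f \<in> alg_carrier (Lp_algebra M 1)"
    using Lp_carrier_subset_L1[of M p] p by auto
  have fM: "f \<in> borel_measurable M" using f by (rule Lp_functions_measurable)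
  have \<phi>_borel: "\<phi> \<in> borel_measurable borel"
    by (intro borel_measurable_continuous_onI linear_continuous_on gelfand_spectrum_type_algebra_bounded_linear[OF \<phi>])
  have "(\<integral>x. cnj (\<gamma> x) * \<phi> (rep (ae_class M f) x) \<partial>M) = (\<integral>x. cnj (\<gamma> x) * \<phi> (f x) \<partial>M)"
  proof (rule integral_cong_AE)
    show "AE x in M. cnj (\<gamma> x) * \<phi> (rep (ae_class M f) x) = cnj (\<gamma> x) * \<phi> (f x)"
      using rep_ae_class(2)[OF fM] by eventually_elim simp
  qed (intro borel_measurable_times dual_group_cnj_measurable[OF \<gamma>] measurable_compose[OF _ \<phi>_borel] rep_ae_class fM)+
  then show ?thesis using X X1 by (simp add: character_tensor_def)
qed

lemma integrable_character:
  fixes f :: "'g \<Rightarrow> 'a::{comm_complex_banach_algebra, second_countable_topology}"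
  assumes \<gamma>: "\<gamma> \<in> dual_group" and \<phi>: "\<phi> \<in> gelfand_spectrum type_algebra" and f: "integrable M f"
  shows "integrable M (\<lambda>x. cnj (\<gamma> x) * \<phi> (f x))"
proof (rule Bochner_Integration.integrable_bound[OF f])
  have "\<phi> \<in> borel_measurable borel"
    by (intro borel_measurable_continuous_onI linear_continuous_on gelfand_spectrum_type_algebra_bounded_linear[OF \<phi>])
  from measurable_compose[OF borel_measurable_integrable[OF f] this]
  show "(\<lambda>x. cnj (\<gamma> x) * \<phi> (f x)) \<in> borel_measurable M"
    by (rule borel_measurable_times[OF dual_group_cnj_measurable[OF \<gamma>]])
qed (auto simp: norm_mult dual_group_norm[OF \<gamma>] gelfand_spectrum_type_algebra_norm_le[OF \<phi>])

proposition character_tensor_in_spectrum: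
  fixes \<phi> :: "'a::{comm_complex_banach_algebra, second_countable_topology} \<Rightarrow> complex"
  assumes \<gamma>: "\<gamma> \<in> dual_group" and \<phi>: "\<phi> \<in> gelfand_spectrum type_algebra" and p: "p > 1"
  shows "restrict (character_tensor M \<gamma> \<phi>) (alg_carrier (Lp_algebra M p)) \<in> gelfand_spectrum (Lp_algebra M p)"
  unfolding gelfand_spectrum_Lp_iff
proof (intro conjI ballI allI)
  note eval_class = character_tensor_ae_class[OF \<gamma> \<phi> _ p]
  note \<phi>' = \<phi>[unfolded gelfand_spectrum_type_algebra_iff]
  have int: "integrable M f" if "f \<in> Lp_functions M p" for f :: "'g \<Rightarrow> 'a"
    using that p by (intro Lp_functions_imp_integrable) auto
  let ?X = "restrict (character_tensor M \<gamma> \<phi>) (alg_carrier (Lp_algebra M p))"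
  show "?X \<in> extensional (alg_carrier (Lp_algebra M p))" by simp
  fix f g :: "'g \<Rightarrow> 'a" assume f: "f \<in> Lp_functions M p"
  show "?X (ae_class M (\<lambda>x. scaleC c (f x))) = c * ?X (ae_class M f)" for c
    using \<phi>' by (simp add: eval_class f Lp_functions_scaleC mult.left_commute del: restrict_apply)
  assume g: "g \<in> Lp_functions M p"
  show "?X (ae_class M (\<lambda>x. f x + g x)) = ?X (ae_class M f) + ?X (ae_class M g)"
    using p \<phi>' integrable_character[OF \<gamma> \<phi> int[OF f]] integrable_character[OF \<gamma> \<phi> int[OF g]]
    by (simp add: eval_class f g Lp_functions_add distrib_left del: restrict_apply)
  show "?X (ae_class M (convolution M f g)) = ?X (ae_class M f) * ?X (ae_class M g)"
    by (simp add: eval_class f g Lp_functions_convolution p integral_character_convolution[OF \<gamma> \<phi> int int] del: restrict_apply)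
next
  \<comment> \<open>The function \<open>\<gamma> a\<close> witnesses nonvanishing, as the functional
    maps it to \<open>\<phi> a\<close>.\<close>
  obtain a where a: "\<phi> a \<noteq> 0"
    using \<phi> by (auto simp: gelfand_spectrum_type_algebra_iff)
  note [measurable] = dual_group_measurable[OF \<gamma>]
  have L: "(\<lambda>x. scaleC (\<gamma> x) a) \<in> Lp_functions M p"
    using p by (intro Lp_functions_bounded[of _ "norm a"]) (auto simp: norm_scaleC dual_group_norm[OF \<gamma>])
  have "restrict (character_tensor M \<gamma> \<phi>) (alg_carrier (Lp_algebra M p)) (ae_class M (\<lambda>x. scaleC (\<gamma> x) a)) = \<phi> a"
    using \<phi> by (simp add: character_tensor_ae_class[OF \<gamma> \<phi> L p] gelfand_spectrum_type_algebra_iff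
        dual_group_cnj_mult[OF \<gamma>] del: restrict_apply flip: mult.assoc)
  with a L show "\<exists>f\<in>Lp_functions M p.
      restrict (character_tensor M \<gamma> \<phi>) (alg_carrier (Lp_algebra M p)) (ae_class M f) \<noteq> 0"
    by (intro bexI[OF _ L]) simp
qed

proposition spectrum_Lp_eq_character_tensor:
  fixes \<Phi> :: "('g \<Rightarrow> 'a::{comm_complex_banach_algebra, second_countable_topology}) set \<Rightarrow> complex"
  assumes \<Phi>: "\<Phi> \<in> gelfand_spectrum (Lp_algebra M p)" and p: "p > 1"
  obtains \<gamma> \<phi> where "\<gamma> \<in> dual_group" "\<phi> \<in> gelfand_spectrum type_algebra"
    "\<Phi> = restrict (character_tensor M \<gamma> \<phi>) (alg_carrier (Lp_algebra M p))"
proof -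
  note \<Phi>' = \<Phi>[unfolded gelfand_spectrum_Lp_iff]
  interpret Lp_functional M p "\<lambda>f. \<Phi> (ae_class M f)"
    by unfold_locales (use p \<Phi>' in \<open>auto intro: arg_cong[OF ae_class_eqI]\<close>)
  obtain f where "f \<in> Lp_functions M p" "\<Phi> (ae_class M f) \<noteq> 0"
    using \<Phi>' by blast
  then obtain \<gamma> \<phi> where \<gamma>: "\<gamma> \<in> dual_group" and \<phi>: "\<phi> \<in> gelfand_spectrum type_algebra"
    and eq: "\<And>f. f \<in> Lp_functions M p \<Longrightarrow> \<Phi> (ae_class M f) = (\<integral>x. cnj (\<gamma> x) * \<phi> (f x) \<partial>M)"
    by (rule ex_character_tensor) (rule that)
  have "\<Phi> = restrict (character_tensor M \<gamma> \<phi>) (alg_carrier (Lp_algebra M p))"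
  proof (rule extensionalityI)
    show "\<Phi> \<in> extensional (alg_carrier (Lp_algebra M p))" using \<Phi>' by blast
    fix X :: "('g \<Rightarrow> 'a) set" assume "X \<in> alg_carrier (Lp_algebra M p)"
    then obtain f where "f \<in> Lp_functions M p" "X = ae_class M f" by (auto simp: Lp_carrier)
    then show "\<Phi> X = restrict (character_tensor M \<gamma> \<phi>) (alg_carrier (Lp_algebra M p)) X"
      by (simp only: eq character_tensor_ae_class[OF \<gamma> \<phi> _ p])
  qed simp
  with \<gamma> \<phi> show thesis by (rule that)
qed

end

theorem proposition2p8:
  fixes M :: "'g::{topological_ab_group_add, t2_space} measure"
    and p :: real
  assumes "compact (UNIV :: 'g set)"
    and "haar_prob_measure M"
    and "1 < p"
  shows "gelfand_spectrum (Lp_algebra M p ::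
      ('g \<Rightarrow> 'a::{comm_complex_banach_algebra, separable_metric_space}) set complex_algebra) =
    {restrict (character_tensor M \<gamma> \<phi>) (alg_carrier (Lp_algebra M p)) | \<gamma> \<phi>.
       \<gamma> \<in> dual_group \<and> \<phi> \<in> gelfand_spectrum type_algebra}"
proof -
  interpret compact_haar M
    using assms(1,2) by unfold_locales
  show ?thesis
    using character_tensor_in_spectrum[OF _ _ assms(3)] spectrum_Lp_eq_character_tensor[OF _ assms(3)]
    by blast
qed

end
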